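(* Let $M$ be a finitely generated left cancellative monoid of bounded indegree which is strongly hyperbolic. Then the $\mathcal{L}$-order and the $\mathcal{R}$-order for $M$ are both in $\mathcal{NP}$.
   Context: Directed graphs may have loops and multiple edges; $d(u,v)$ is the length of a shortest directed path from $u$ to $v$ ($\infty$ if none). Out-ball $\overrightarrow{\mathcal{B}}_r(x)=\{y : d(x,y)\le r\}$, in-ball $\overleftarrow{\mathcal{B}}_r(x)=\{y : d(y,x)\le r\}$, extended to sets by union. A path $[x_0,\dots,x_n]$ is a geodesic if $n=d(x_0,x_n)$. A directed geodesic triangle is an ordered triple $(p,q,r)$ of geodesics with the end of $p$ equal to the start of $q$ and $p\circ q$ having the same start and end as $r$; it is $\delta$-thin if every vertex of $r$ lies in $\overrightarrow{\mathcal{B}}_\delta(p)\cup\overleftarrow{\mathcal{B}}_\delta(q)$, every vertex of $p$ lies in $\overrightarrow{\mathcal{B}}_\delta(r)\cup\overleftarrow{\mathcal{B}}_\delta(q)$, and every vertex of $q$ lies in $\overrightarrow{\mathcal{B}}_\delta(p)\cup\overleftarrow{\mathcal{B}}_\delta(r)$. A directed graph is strongly $\delta$-hyperbolic if all its directed geodesic triangles are $\delta$-thin. For a monoid $M$ generated by a finite set $A$, the right Cayley graph has vertex set $M$ and an edge $m\to n$ for each $a\in A$ with $ma=n$. $M$ is strongly hyperbolic if its right Cayley graph with respect to some finite generating set is strongly $\delta$-hyperbolic for some $\delta\ge0$. $M$ has bounded indegree if for a finite generating set $A$ there is $\alpha$ such that no $a\in A$ and $\alpha+1$ distinct $x_0,\dots,x_\alpha\in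 M$ satisfy $x_0a=\dots=x_\alpha a$. Green's orders: $x\le_{\mathcal{R}} y$ iff $xM\subseteq yM$; $x\le_{\mathcal{L}} y$ iff $Mx\subseteq My$. A relation being "in $\mathcal{NP}$" means: deciding, given two words over a finite generating set, whether the elements they represent are related, is in $\mathcal{NP}$. *)

theory Defs
  imports Main "HOL-Library.Extended_Nat"
begin

definition generates :: "'m::monoid_mult set \<Rightarrow> bool" where
  "generates A \<longleftrightarrow> (\<forall>m. \<exists>w. set w \<subseteq> A \<and> prod_list w = m)"

definition left_cancellative :: "'m::monoid_mult itself \<Rightarrow> bool" where
  "left_cancellative _ \<longleftrightarrow> (\<forall>a b c::'m. a * b = a * c \<longrightarrow> b = c)"

text \<open>edge m \<rightarrow> n iff m a = n for some generator a (multiplicities are irrelevant for distances)\<close>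
definition cedge :: "'m::monoid_mult set \<Rightarrow> 'm \<Rightarrow> 'm \<Rightarrow> bool" where
  "cedge A x y \<longleftrightarrow> (\<exists>a\<in>A. x * a = y)"

definition cpath :: "'m::monoid_mult set \<Rightarrow> 'm list \<Rightarrow> bool" where
  "cpath A p \<longleftrightarrow> p \<noteq> [] \<and> (\<forall>i. Suc i < length p \<longrightarrow> cedge A (p ! i) (p ! Suc i))"

text \<open>directed distance; infinity if no path (Inf of the empty set of enat is infinity)\<close>
definition cdist :: "'m::monoid_mult set \<Rightarrow> 'm \<Rightarrow> 'm \<Rightarrow> enat" where
  "cdist A u v = (INF p\<in>{p. cpath A p \<and> hd p = u \<and> last p = v}. enat (length p - 1))"

definition geodesic :: "'m::monoid_mult set \<Rightarrow> 'm list \<Rightarrow> bool" where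
  "geodesic A p \<longleftrightarrow> cpath A p \<and> cdist A (hd p) (last p) = enat (length p - 1)"

definition in_out_ball :: "'m::monoid_mult set \<Rightarrow> nat \<Rightarrow> 'm list \<Rightarrow> 'm \<Rightarrow> bool" where
  "in_out_ball A d p y \<longleftrightarrow> (\<exists>x\<in>set p. cdist A x y \<le> enat d)"

definition in_in_ball :: "'m::monoid_mult set \<Rightarrow> nat \<Rightarrow> 'm list \<Rightarrow> 'm \<Rightarrow> bool" where
  "in_in_ball A d q y \<longleftrightarrow> (\<exists>x\<in>set q. cdist A y x \<le> enat d)"

definition geodesic_triangle :: "'m::monoid_mult set \<Rightarrow> 'm list \<Rightarrow> 'm list \<Rightarrow> 'm list \<Rightarrow> bool" where
  "geodesic_triangle A p q r \<longleftrightarrow> geodesic A p \<and> geodesic A q \<and> geodesic A r \<and>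
     last p = hd q \<and> hd r = hd p \<and> last r = last q"

definition thin_triangle :: "'m::monoid_mult set \<Rightarrow> nat \<Rightarrow> 'm list \<Rightarrow> 'm list \<Rightarrow> 'm list \<Rightarrow> bool" where
  "thin_triangle A d p q r \<longleftrightarrow>
     (\<forall>v\<in>set r. in_out_ball A d p v \<or> in_in_ball A d q v) \<and>
     (\<forall>v\<in>set p. in_out_ball A d r v \<or> in_in_ball A d q v) \<and>
     (\<forall>v\<in>set q. in_out_ball A d p v \<or> in_in_ball A d r v)"

definition strongly_hyperbolic_cayley :: "'m::monoid_mult set \<Rightarrow> nat \<Rightarrow> bool" where
  "strongly_hyperbolic_cayley A d \<longleftrightarrow>
     (\<forall>p q r. geodesic_triangle A p q r \<longrightarrow> thin_triangle A d p q r)"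

definition strongly_hyperbolic_monoid :: "'m::monoid_mult itself \<Rightarrow> bool" where
  "strongly_hyperbolic_monoid _ \<longleftrightarrow>
     (\<exists>B::'m set. finite B \<and> generates B \<and> (\<exists>d. strongly_hyperbolic_cayley B d))"

definition bounded_indegree :: "'m::monoid_mult set \<Rightarrow> bool" where
  "bounded_indegree A \<longleftrightarrow> (\<exists>\<alpha>::nat. \<forall>a\<in>A. \<forall>y. finite {x. x * a = y} \<and> card {x. x * a = y} \<le> \<alpha>)"

definition R_le :: "'m::monoid_mult \<Rightarrow> 'm \<Rightarrow> bool" where
  "R_le x y \<longleftrightarrow> range (\<lambda>m. x * m) \<subseteq> range (\<lambda>m. y * m)"

definition L_le :: "'m::monoid_mult \<Rightarrow> 'm \<Rightarrow> bool" where
  "L_le x y \<longleftrightarrow> range (\<lambda>m. m * x) \<subseteq> range (\<lambda>m. m * y)"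

text \<open>Single two-way-infinite tape, tape symbols and states are naturals, 0 is the blank.
  A transition (q, b, q', b', d) means: in state q reading b, go to q', write b', move by d.\<close>
type_synonym ntm_trans = "(nat \<times> nat \<times> nat \<times> nat \<times> int) set"
type_synonym config = "nat \<times> (int \<Rightarrow> nat) \<times> int"

definition ntm_step :: "ntm_trans \<Rightarrow> config \<Rightarrow> config \<Rightarrow> bool" where
  "ntm_step \<delta> c c' \<longleftrightarrow> (case c of (q, t, h) \<Rightarrow>
     (\<exists>q' b' d. (q, t h, q', b', d) \<in> \<delta> \<and> d \<in> {-1, 0, 1} \<and> c' = (q', t(h := b'), h + d)))"

definition init_config :: "nat \<Rightarrow> nat list \<Rightarrow> config" where
  "init_config q0 w = (q0, (\<lambda>i. if 0 \<le> i \<and> nat i < length w then w ! nat i else 0), 0)"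

definition ntm_accepts_within :: "ntm_trans \<Rightarrow> nat \<Rightarrow> nat \<Rightarrow> nat list \<Rightarrow> nat \<Rightarrow> bool" where
  "ntm_accepts_within \<delta> q0 qa w N \<longleftrightarrow>
     (\<exists>n\<le>N. \<exists>t h. (ntm_step \<delta> ^^ n) (init_config q0 w) (qa, t, h))"

text \<open>A binary relation on M is in NP (w.r.t. the finite generating set A): the problem
  "given words u, v over A, is (u, v) related?", with input encoded as u # v over the
  alphabet A plus a separator (None), is accepted by a nondeterministic TM within polynomial time.\<close>
definition rel_in_NP :: "'m::monoid_mult set \<Rightarrow> ('m \<Rightarrow> 'm \<Rightarrow> bool) \<Rightarrow> bool" where
  "rel_in_NP A Rel \<longleftrightarrow>
     (\<exists>(enc :: 'm option \<Rightarrow> nat) (\<delta> :: ntm_trans) q0 qa (c::nat) (k::nat).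
        finite \<delta> \<and> inj_on enc (insert None (Some ` A)) \<and> 0 \<notin> enc ` (insert None (Some ` A)) \<and>
        (\<forall>u v. set u \<subseteq> A \<and> set v \<subseteq> A \<longrightarrow>
           (Rel (prod_list u) (prod_list v) \<longleftrightarrow>
            ntm_accepts_within \<delta> q0 qa (map enc (map Some u @ [None] @ map Some v))
              (c * (length u + length v + 1) ^ k + c))))"

end

theory Submission
  imports Defs "HOL-Library.Nat_Bijection"
begin

text \<open>Let \<open>p\<close> and \<open>r\<close> be geodesic words for \<open>g\<close> and \<open>g a\<close>, where \<open>a\<close> is short. Thinness of the triangle
  together with bounded indegree and left cancellativity shows that, up to a bounded delay \<open>C\<close>, the
  prefix of \<open>r\<close> of length \<open>i\<close> is the prefix of \<open>p\<close> of length \<open>i - C\<close> times an element of a fixed finite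
  ball \<open>S\<close>. Hence a machine whose state carries one element of \<open>S\<close> rewrites \<open>p a\<close> into \<open>r\<close> in a single
  sweep over the tape, and any word is brought into geodesic form by linearly many sweeps.

  If \<open>x = m y\<close> or \<open>x = y m\<close>, every vertex on the geodesic triangle's side labelled by \<open>m\<close> lies in a ball
  around one of the other two sides; these balls are uniformly finite, so \<open>m\<close> has length linear in
  that of \<open>x\<close> and \<open>y\<close>. A nondeterministic machine guesses \<open>m\<close>, puts \<open>x\<close> on one track and \<open>m y\<close> (or \<open>y m\<close>)
  on a second one, sweeps both tracks into the same geodesic word, and compares them, all in
  quadratic time. Sweeps preserve the products of the tracks, so it never accepts wrongly.\<close>

section \<open>Turing machines on list zippers\<close>

definition rd :: "nat list \<Rightarrow> nat" where
  "rd xs = (case xs of [] \<Rightarrow> 0 | x # _ \<Rightarrow> x)"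

lemma rd_simps [simp]: "rd [] = 0" "rd (x # xs) = x"
  by (simp_all add: rd_def)

definition nth0 :: "nat list \<Rightarrow> nat \<Rightarrow> nat" where
  "nth0 xs n = (if n < length xs then xs ! n else 0)"

lemma nth0_simps [simp]: "nth0 [] n = 0" "nth0 (x # xs) 0 = x" "nth0 (x # xs) (Suc n) = nth0 xs n"
  by (simp_all add: nth0_def)

lemma nth0_0: "nth0 xs 0 = rd xs"
  by (cases xs) auto

lemma nth0_tl: "nth0 (tl xs) n = nth0 xs (Suc n)"
  by (cases xs) auto

text \<open>The tape with head position h whose content is L to the left of the head
  (nearest cell first) and R from the head onwards.\<close>
definition tape :: "nat list \<Rightarrow> nat list \<Rightarrow> int \<Rightarrow> int \<Rightarrow> nat" where
  "tape L R h i = (if i < h then nth0 L (nat (h - 1 - i)) else nth0 R (nat (i - h)))"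

type_synonym zipper = "nat \<times> nat list \<times> nat list"

text \<open>The last branch is the move to the left. There \<open>rd L\<close> supplies a blank once
  the recorded part of the tape is used up, so \<open>L\<close> and \<open>R\<close> need only cover
  a finite window.\<close>

definition zmove :: "int \<Rightarrow> nat list \<Rightarrow> nat \<Rightarrow> nat list \<Rightarrow> nat list \<times> nat list" where
  "zmove d L b R = (if d = 1 then (b # L, R) else if d = 0 then (L, b # R) else (tl L, rd L # b # R))"

definition zstep :: "ntm_trans \<Rightarrow> zipper \<Rightarrow> zipper \<Rightarrow> bool" where
  "zstep \<delta> z z' \<longleftrightarrow> (case z of (q, L, R) \<Rightarrow>
     \<exists>q' b d. (q, rd R, q', b, d) \<in> \<delta> \<and> d \<in> {-1, 0, 1} \<and> z' = (q', zmove d L b (tl R)))"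

definition config_of :: "zipper \<Rightarrow> int \<Rightarrow> config" where
  "config_of z h = (case z of (q, L, R) \<Rightarrow> (q, tape L R h, h))"

lemma tape_read: "tape L R h h = rd R"
  by (simp add: tape_def nth0_0)

lemma tape_write_move:
  assumes "d \<in> {-1, 0, 1}"
  shows "(tape L R h)(h := b) = tape (fst (zmove d L b (tl R))) (snd (zmove d L b (tl R))) (h + d)"
proof
  fix i
  consider "d = 1" | "d = 0" | "d = -1" using assms by auto
  then show "((tape L R h)(h := b)) i = tape (fst (zmove d L b (tl R))) (snd (zmove d L b (tl R))) (h + d) i"
  proof cases
    case 1
    consider "i < h" | "i = h" | "i > h" by linarith
    then show ?thesis
    proof cases
      case a: 1
      then have "nat (h - i) = Suc (nat (h - 1 - i))" by simp
      then show ?thesis using 1 a by (simp add: tape_def zmove_def)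
    next
      case a: 3
      then have "nat (i - h) = Suc (nat (i - (h + 1)))" by simp
      then show ?thesis using 1 a by (simp add: tape_def zmove_def nth0_tl)
    qed (use 1 in \<open>simp add: tape_def zmove_def\<close>)
  next
    case 2
    consider "i < h" | "i = h" | "i > h" by linarith
    then show ?thesis
    proof cases
      case a: 3
      then have "nat (i - h) = Suc (nat (i - h - 1))" by simp
      then show ?thesis using 2 a by (simp add: tape_def zmove_def nth0_tl)
    qed (use 2 in \<open>simp_all add: tape_def zmove_def\<close>)
  next
    case 3
    consider "i < h - 1" | "i = h - 1" | "i = h" | "i > h" by linarith
    then show ?thesis
    proof cases
      case a: 1
      then have "nat (h - 1 - i) = Suc (nat (h - 1 - 1 - i))" by simp
      then show ?thesis using 3 a by (simp add: tape_def zmove_def nth0_tl)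
    next
      case a: 4
      then have "nat (i - h) = Suc (nat (i - h - 1))" "nat (i - (h - 1)) = Suc (Suc (nat (i - h - 1)))" by simp_all
      then show ?thesis using 3 a by (simp add: tape_def zmove_def nth0_tl)
    qed (use 3 in \<open>simp_all add: tape_def zmove_def nth0_0\<close>)
  qed
qed

lemma config_of_move:
  "d \<in> {-1, 0, 1} \<Longrightarrow> config_of (q', zmove d L b (tl R)) (h + d) = (q', (tape L R h)(h := b), h + d)"
  unfolding config_of_def using tape_write_move[of d L R h b] by (simp add: split_beta)

text \<open>\<open>config_of\<close> is not injective, as trailing blanks of the lists leave the
  tape unchanged. The simulation is therefore shown in each direction separately.\<close>

lemma ntm_step_zstep:
  assumes "ntm_step \<delta> (config_of z h) c" shows "\<exists>z' h'. zstep \<delta> z z' \<and> c = config_of z' h'"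
proof -
  obtain q L R where z: "z = (q, L, R)" by (cases z)
  from assms obtain q' b d where t: "(q, rd R, q', b, d) \<in> \<delta>" "d \<in> {-1, 0, 1}"
    and c: "c = (q', (tape L R h)(h := b), h + d)"
    unfolding z config_of_def ntm_step_def by (auto simp: tape_read)
  have "zstep \<delta> z (q', zmove d L b (tl R))" unfolding zstep_def z using t by auto
  moreover have "c = config_of (q', zmove d L b (tl R)) (h + d)" using c config_of_move[OF t(2)] by simp
  ultimately show ?thesis by blast
qed

lemma zstep_ntm_step:
  assumes "zstep \<delta> z z'" shows "\<exists>h'. ntm_step \<delta> (config_of z h) (config_of z' h')"
proof -
  obtain q L R where z: "z = (q, L, R)" by (cases z)
  from assms obtain q' b d where t: "(q, rd R, q', b, d) \<in> \<delta>" "d \<in> {-1, 0, 1}"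
    and z': "z' = (q', zmove d L b (tl R))"
    unfolding z zstep_def by auto
  have "ntm_step \<delta> (config_of z h) (q', (tape L R h)(h := b), h + d)"
    unfolding z config_of_def ntm_step_def using t by (auto simp: tape_read)
  then show ?thesis unfolding z' config_of_move[OF t(2), symmetric] by blast
qed

lemma ntm_run_zrun:
  "(ntm_step \<delta> ^^ n) (config_of z h) c \<Longrightarrow> \<exists>z' h'. (zstep \<delta> ^^ n) z z' \<and> c = config_of z' h'"
proof (induction n arbitrary: c)
  case (Suc n)
  then obtain c' where c': "(ntm_step \<delta> ^^ n) (config_of z h) c'" "ntm_step \<delta> c' c" by auto
  from Suc.IH[OF c'(1)] obtain z' h' where "(zstep \<delta> ^^ n) z z'" "c' = config_of z' h'" by blast
  moreover from this ntm_step_zstep[of \<delta> z' h' c] c'(2)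
  obtain z'' h'' where "zstep \<delta> z' z''" "c = config_of z'' h''" by blast
  ultimately show ?case using relpowp_Suc_I by metis
qed auto

lemma zrun_ntm_run:
  "(zstep \<delta> ^^ n) z z' \<Longrightarrow> \<exists>h'. (ntm_step \<delta> ^^ n) (config_of z h) (config_of z' h')"
proof (induction n arbitrary: z')
  case (Suc n)
  then obtain z1 where z1: "(zstep \<delta> ^^ n) z z1" "zstep \<delta> z1 z'" by auto
  from Suc.IH[OF z1(1)] obtain h1 where "(ntm_step \<delta> ^^ n) (config_of z h) (config_of z1 h1)" by blast
  moreover obtain h' where "ntm_step \<delta> (config_of z1 h1) (config_of z' h')"
    using zstep_ntm_step[OF z1(2)] by blast
  ultimately show ?case using relpowp_Suc_I by metis
qed auto

lemma init_config_config_of: "init_config q w = config_of (q, [], w) 0"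
  unfolding init_config_def config_of_def by (auto simp: tape_def nth0_def)

text \<open>Acceptance depends only on the state, which \<open>config_of\<close> preserves, so the
  two simulations suffice.\<close>

lemma accepts_within_iff:
  "ntm_accepts_within \<delta> q0 qa w N \<longleftrightarrow> (\<exists>n\<le>N. \<exists>L R. (zstep \<delta> ^^ n) (q0, [], w) (qa, L, R))"
proof -
  have "(\<exists>t h. (ntm_step \<delta> ^^ n) (config_of (q0, [], w) 0) (qa, t, h)) \<longleftrightarrow>
      (\<exists>L R. (zstep \<delta> ^^ n) (q0, [], w) (qa, L, R))" for n
  proof
    assume "\<exists>t h. (ntm_step \<delta> ^^ n) (config_of (q0, [], w) 0) (qa, t, h)"
    then obtain z' t h h' where "(zstep \<delta> ^^ n) (q0, [], w) z'" "(qa, t, h) = config_of z' h'"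
      using ntm_run_zrun by blast
    then show "\<exists>L R. (zstep \<delta> ^^ n) (q0, [], w) (qa, L, R)"
      by (cases z') (auto simp: config_of_def)
  next
    assume "\<exists>L R. (zstep \<delta> ^^ n) (q0, [], w) (qa, L, R)"
    then obtain L R where "(zstep \<delta> ^^ n) (q0, [], w) (qa, L, R)" by blast
    from zrun_ntm_run[OF this, of 0] show "\<exists>t h. (ntm_step \<delta> ^^ n) (config_of (q0, [], w) 0) (qa, t, h)"
      by (auto simp: config_of_def[of "(qa, L, R)"])
  qed
  then show ?thesis unfolding ntm_accepts_within_def init_config_config_of by simp
qed

section \<open>Single moves and straight runs of the head\<close>

lemma zstep_right: "(q, b, q', b', 1) \<in> \<delta> \<Longrightarrow> zstep \<delta> (q, L, b # R) (q', b' # L, R)"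
  unfolding zstep_def prod.case
  by (rule exI[of _ q'], rule exI[of _ b'], rule exI[of _ "1"]) (simp add: zmove_def)

lemma zstep_right_blank: "(q, 0, q', b', 1) \<in> \<delta> \<Longrightarrow> zstep \<delta> (q, L, []) (q', b' # L, [])"
  unfolding zstep_def prod.case
  by (rule exI[of _ q'], rule exI[of _ b'], rule exI[of _ "1"]) (simp add: zmove_def)

lemma zstep_stay_blank: "(q, 0, q', b', 0) \<in> \<delta> \<Longrightarrow> zstep \<delta> (q, L, []) (q', L, [b'])"
  unfolding zstep_def prod.case
  by (rule exI[of _ q'], rule exI[of _ b'], rule exI[of _ "0"]) (simp add: zmove_def)

lemma zstep_stay: "(q, b, q', b', 0) \<in> \<delta> \<Longrightarrow> zstep \<delta> (q, L, b # R) (q', L, b' # R)"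
  unfolding zstep_def prod.case
  by (rule exI[of _ q'], rule exI[of _ b'], rule exI[of _ "0"]) (simp add: zmove_def)

text \<open>The configuration after the head has moved left onto the first cell of L.\<close>
definition onto :: "nat \<Rightarrow> nat list \<Rightarrow> nat list \<Rightarrow> zipper" where
  "onto q L R = (q, tl L, rd L # R)"

lemma onto_Cons [simp]: "onto q (b # L) R = (q, L, b # R)"
  by (simp add: onto_def)

lemma zstep_left: "(q, b, q', b', -1) \<in> \<delta> \<Longrightarrow> zstep \<delta> (q, L, b # R) (onto q' L (b' # R))"
  unfolding zstep_def onto_def prod.case
  by (rule exI[of _ q'], rule exI[of _ b'], rule exI[of _ "-1"]) (simp add: zmove_def)

lemma relpowp_trans: "(R ^^ m) x y \<Longrightarrow> (R ^^ n) y z \<Longrightarrow> (R ^^ (m + n)) x z"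
  unfolding relpowp_add by blast

lemma relpowp_step: "R x y \<Longrightarrow> (R ^^ n) y z \<Longrightarrow> (R ^^ Suc n) x z"
  by (rule relpowp_Suc_I2)

text \<open>The state \<open>q i\<close> belongs to the boundary before cell \<open>i\<close>, just
  as the carries of \<open>sweep\<close> do below; a constant \<open>q\<close> covers passes that
  carry nothing.\<close>

lemma run_right:
  "length xs = length ys \<Longrightarrow> (\<And>i. i < length xs \<Longrightarrow> (q i, xs ! i, q (Suc i), ys ! i, 1) \<in> \<delta>) \<Longrightarrow>
   (zstep \<delta> ^^ length xs) (q 0, L, xs @ R) (q (length xs), rev ys @ L, R)"
proof (induction xs ys arbitrary: q L rule: list_induct2)
  case (Cons x xs y ys)
  have "zstep \<delta> (q 0, L, x # xs @ R) (q 1, y # L, xs @ R)"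
    using Cons.prems[of 0] by (auto intro: zstep_right)
  moreover have "(zstep \<delta> ^^ length xs) (q 1, y # L, xs @ R) (q (Suc (length xs)), rev ys @ y # L, R)"
    using Cons.IH[of "\<lambda>i. q (Suc i)" "y # L"] Cons.prems[of "Suc _"] by simp
  ultimately show ?case using relpowp_step[of "zstep \<delta>"] by fastforce
qed simp

text \<open>Cell \<open>i\<close> is reached from its right, hence read in state
  \<open>q (Suc i)\<close> and left in \<open>q i\<close>. The cells are met from last to first, so
  the induction is at the end of \<open>xs\<close>.\<close>

lemma run_left:
  "length xs = length ys \<Longrightarrow> (\<And>i. i < length xs \<Longrightarrow> (q (Suc i), xs ! i, q i, ys ! i, -1) \<in> \<delta>) \<Longrightarrow>
   (zstep \<delta> ^^ length xs) (onto (q (length xs)) (rev xs @ L) R) (onto (q 0) L (ys @ R))"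
proof (induction xs arbitrary: ys R rule: rev_induct)
  case (snoc x xs)
  then obtain ys' y where ys: "ys = ys' @ [y]" by (cases ys rule: rev_cases) auto
  have "zstep \<delta> (q (Suc (length xs)), rev xs @ L, x # R) (onto (q (length xs)) (rev xs @ L) (y # R))"
    using snoc.prems(2)[of "length xs"] snoc.prems(1) ys by (auto intro!: zstep_left)
  moreover have "(zstep \<delta> ^^ length xs) (onto (q (length xs)) (rev xs @ L) (y # R)) (onto (q 0) L (ys' @ y # R))"
  proof (rule snoc.IH)
    show "length xs = length ys'" using snoc.prems ys by simp
    show "(q (Suc i), xs ! i, q i, ys' ! i, -1) \<in> \<delta>" if "i < length xs" for i
      using snoc.prems(2)[of i] snoc.prems(1) ys that by (simp add: nth_append)
  qed
  ultimately show ?case using relpowp_step[of "zstep \<delta>"] ys by fastforce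
qed simp

section \<open>The sweeping machine\<close>

text \<open>One pass from right to left turns X into Y, where f i is carried across the boundary before
  cell i; read in the other direction, the same carries turn Y into X.\<close>
definition sweep :: "'m::monoid_mult set \<Rightarrow> 'm list \<Rightarrow> 'm list \<Rightarrow> bool" where
  "sweep S X Y \<longleftrightarrow> length X = length Y \<and> set X \<subseteq> S \<and> set Y \<subseteq> S \<and>
     (\<exists>f. f 0 = 1 \<and> f (length X) = 1 \<and> (\<forall>i\<le>length X. f i \<in> S) \<and>
          (\<forall>i<length X. X ! i * f (Suc i) = f i * Y ! i))"

text \<open>The return pass from \<open>Z\<close> to \<open>Y\<close> is a pass from
  \<open>Y\<close> to \<open>Z\<close> read backwards, hence the order of the arguments in the
  second conjunct.\<close>

definition sweep_round :: "'m::monoid_mult set \<Rightarrow> 'm list \<Rightarrow> 'm list \<Rightarrow> bool" where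
  "sweep_round S X Y \<longleftrightarrow> (\<exists>Z. sweep S X Z \<and> sweep S Y Z)"

text \<open>States and tape symbols alike are codes of a tag and two monoid elements.
  \<open>S\<close> is the finite supply of cell entries and carries; \<open>GL\<close> and
  \<open>GR\<close> hold the letters that may be guessed as left and right factors of the second
  word.\<close>

locale sweep_machine =
  fixes sy :: "nat \<Rightarrow> 'm::monoid_mult \<Rightarrow> 'm \<Rightarrow> nat"
    and S A GL GR :: "'m set"
  assumes sy_eq [simp]: "sy k x y = sy k' x' y' \<longleftrightarrow> k = k' \<and> x = x' \<and> y = y'"
    and sy_nonzero [simp]: "sy k x y \<noteq> 0"
    and finite_S: "finite S"
    and A_S: "A \<subseteq> S" and GL_S: "GL \<subseteq> S" and GR_S: "GR \<subseteq> S"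
    and one_GL [simp]: "1 \<in> GL" and one_GR [simp]: "1 \<in> GR"
begin

lemma one_S [simp]: "1 \<in> S"
  using GL_S one_GL by blast

lemma zero_sy [simp]: "0 \<noteq> sy k x y" "0 < sy k x y"
  using sy_nonzero neq0_conv by metis+

definition cell :: "'m \<times> 'm \<Rightarrow> nat" where
  "cell z = sy 3 (fst z) (snd z)"

text \<open>The tags have to avoid those of \<open>cell\<close>, \<open>lmark\<close> and
  \<open>rmark\<close>. States may reuse them, because a state is never compared with a
  symbol.\<close>

definition enc :: "'m option \<Rightarrow> nat" where
  "enc o' = (case o' of None \<Rightarrow> sy 8 1 1 | Some a \<Rightarrow> sy 2 a 1)"

abbreviation lmark where "lmark \<equiv> sy 4 1 1"
abbreviation rmark where "rmark \<equiv> sy 5 1 1"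

text \<open>In states with tag 4 the carried pair belongs just to the right of the scanned cell, in
  states with tag 5 just to its left; so a sweep changes neither track's product.\<close>
inductive_set delta :: ntm_trans where
  start: "b = enc None \<or> (\<exists>a\<in>A. b = enc (Some a)) \<Longrightarrow> (sy 0 1 1, b, sy 8 1 1, b, -1) \<in> delta"
| guess_left: "y \<in> GL \<Longrightarrow> (sy 8 1 1, 0, sy 8 1 1, cell (1, y), -1) \<in> delta"
| mark_left: "(sy 8 1 1, 0, sy 2 1 1, lmark, 1) \<in> delta"
| pass_guess: "y \<in> GL \<Longrightarrow> (sy 2 1 1, cell (1, y), sy 2 1 1, cell (1, y), 1) \<in> delta"
| read_first: "a \<in> A \<Longrightarrow> (sy 2 1 1, enc (Some a), sy 2 1 1, cell (a, 1), 1) \<in> delta"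
| separator: "(sy 2 1 1, enc None, sy 3 1 1, cell (1, 1), 1) \<in> delta"
| read_second: "a \<in> A \<Longrightarrow> (sy 3 1 1, enc (Some a), sy 3 1 1, cell (1, a), 1) \<in> delta"
| guess_right: "y \<in> GR \<Longrightarrow> (sy 3 1 1, 0, sy 3 1 1, cell (1, y), 1) \<in> delta"
| mark_right: "(sy 3 1 1, 0, sy 5 1 1, rmark, 0) \<in> delta"
| sweep_left: "{c, d, c', d', x, y, x', y'} \<subseteq> S \<Longrightarrow> x * c = c' * x' \<Longrightarrow> y * d = d' * y' \<Longrightarrow>
    (sy 4 c d, cell (x, y), sy 4 c' d', cell (x', y'), -1) \<in> delta"
| turn_left: "(sy 4 1 1, lmark, sy 5 1 1, lmark, 1) \<in> delta"
| sweep_right: "{c, d, c', d', x, y, x', y'} \<subseteq> S \<Longrightarrow> c * x = x' * c' \<Longrightarrow> d * y = y' * d' \<Longrightarrow>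
    (sy 5 c d, cell (x, y), sy 5 c' d', cell (x', y'), 1) \<in> delta"
| turn_right: "(sy 5 1 1, rmark, sy 4 1 1, rmark, -1) \<in> delta"
| check_start: "(sy 5 1 1, rmark, sy 6 1 1, rmark, -1) \<in> delta"
| check: "x \<in> S \<Longrightarrow> (sy 6 1 1, cell (x, x), sy 6 1 1, cell (x, x), -1) \<in> delta"
| accept: "(sy 6 1 1, lmark, sy 7 1 1, lmark, 0) \<in> delta"

text \<open>Every rule uses tags up to 8 and elements of \<open>S\<close>, so all states and symbols
  lie in one finite set \<open>T\<close> of codes that also contains the blank.\<close>

lemma finite_delta: "finite delta"
proof (rule finite_subset)
  define T where "T = insert 0 ((\<lambda>(k, x, y). sy k x y) ` ({..8} \<times> S \<times> S))"
  have T: "sy k x y \<in> T" if "k \<le> 8" "x \<in> S" "y \<in> S" for k x y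
    unfolding T_def by (rule insertI2, rule image_eqI[of _ _ "(k, x, y)"]) (use that in auto)
  have T0: "0 \<in> T" unfolding T_def by simp
  show "delta \<subseteq> T \<times> T \<times> T \<times> T \<times> {-1, 0, 1}"
  proof
    fix t assume "t \<in> delta"
    moreover obtain q b q' b' d where t: "t = (q, b, q', b', d)" by (cases t)
    ultimately have "(q, b, q', b', d) \<in> delta" by simp
    then show "t \<in> T \<times> T \<times> T \<times> T \<times> {-1, 0, 1}" unfolding t
      by cases (use A_S GL_S GR_S in \<open>auto simp: cell_def enc_def T0 intro!: T\<close>)
  qed
  show "finite (T \<times> T \<times> T \<times> T \<times> {-1, 0, 1::int})" unfolding T_def using finite_S by simp
qed

inductive_simps delta_simps:
  "(sy 0 c d, b, q', b', e) \<in> delta"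
  "(sy 2 c d, b, q', b', e) \<in> delta"
  "(sy 3 c d, b, q', b', e) \<in> delta"
  "(sy 4 c d, b, q', b', e) \<in> delta"
  "(sy 5 c d, b, q', b', e) \<in> delta"
  "(sy 6 c d, b, q', b', e) \<in> delta"
  "(sy 7 c d, b, q', b', e) \<in> delta"
  "(sy 8 c d, b, q', b', e) \<in> delta"

lemma cell_eq [simp]: "cell z = cell z' \<longleftrightarrow> z = z'"
  by (auto simp: cell_def prod_eq_iff)

lemma code_neq [simp]: "cell z \<noteq> 0" "0 \<noteq> cell z" "cell z \<noteq> enc o'" "enc o' \<noteq> cell z" "enc o' \<noteq> 0" "0 \<noteq> enc o'"
  "k \<noteq> 3 \<Longrightarrow> cell z \<noteq> sy k x y" "k \<noteq> 3 \<Longrightarrow> sy k x y \<noteq> cell z"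
  by (auto simp: cell_def enc_def split: option.splits)

lemma enc_eq [simp]: "enc o1 = enc o2 \<longleftrightarrow> o1 = o2"
  by (auto simp: enc_def split: option.splits)

section \<open>Soundness: an invariant of all runs from an input\<close>

definition input :: "'m list \<Rightarrow> 'm list \<Rightarrow> nat list" where
  "input u v = map enc (map Some u @ [None] @ map Some v)"

text \<open>With \<open>GR = {1}\<close> these are the left multiples of \<open>y\<close> by
  products over \<open>GL\<close>, with \<open>GL = {1}\<close> the right multiples by products over
  \<open>GR\<close>; each of the two orders is one of these cases.\<close>

definition products :: "'m \<Rightarrow> 'm set" where
  "products y = {prod_list l * y * prod_list r |l r. set l \<subseteq> GL \<and> set r \<subseteq> GR}"

text \<open>One clause for each phase: start (tag 0), guessing on the left (8), reading the first
  word (2), reading the second and guessing on the right (3), sweeping left (4) and right (5),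
  comparing (6), acceptance (7). The carries \<open>c\<close> and \<open>d\<close> enter the
  products at the place where the tape is being rewritten. Primed words are still to be read; in
  \<open>s6\<close> the part \<open>Q\<close> has already been compared.\<close>

inductive sound :: "'m list \<Rightarrow> 'm list \<Rightarrow> zipper \<Rightarrow> bool" for u v where
  s0: "sound u v (sy 0 1 1, [], input u v)"
| s1: "set l \<subseteq> GL \<Longrightarrow> sound u v (sy 8 1 1, [], 0 # map (\<lambda>y. cell (1, y)) l @ input u v)"
| s2: "prod_list (map fst zs) * prod_list u' = prod_list u \<Longrightarrow>
    prod_list (map snd zs) * prod_list l' = prod_list l \<Longrightarrow> set l \<subseteq> GL \<Longrightarrow>
    sound u v (sy 2 1 1, rev (map cell zs) @ [lmark], map (\<lambda>y. cell (1, y)) l' @ input u' v)"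
| s3: "prod_list (map fst zs) = prod_list u \<Longrightarrow>
    prod_list (map snd zs) * prod_list v' \<in> products (prod_list v) \<Longrightarrow>
    sound u v (sy 3 1 1, rev (map cell zs) @ [lmark], map (enc \<circ> Some) v')"
| s4: "prod_list (map fst P) * c * prod_list (map fst Q) = prod_list u \<Longrightarrow>
    prod_list (map snd P) * d * prod_list (map snd Q) \<in> products (prod_list v) \<Longrightarrow>
    sound u v (onto (sy 4 c d) (rev (map cell P) @ [lmark]) (map cell Q @ [rmark]))"
| s5: "prod_list (map fst P) * c * prod_list (map fst Q) = prod_list u \<Longrightarrow>
    prod_list (map snd P) * d * prod_list (map snd Q) \<in> products (prod_list v) \<Longrightarrow>
    sound u v (sy 5 c d, rev (map cell P) @ [lmark], map cell Q @ [rmark])"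
| s6: "prod_list (map fst P) * prod_list (map fst Q) = prod_list u \<Longrightarrow>
    prod_list (map snd P) * prod_list (map snd Q) \<in> products (prod_list v) \<Longrightarrow>
    map fst Q = map snd Q \<Longrightarrow>
    sound u v (onto (sy 6 1 1) (rev (map cell P) @ [lmark]) (map cell Q @ [rmark]))"
| s7: "prod_list u \<in> products (prod_list v) \<Longrightarrow> sound u v (sy 7 1 1, L, R)"


lemma products_guess: "set l \<subseteq> GL \<Longrightarrow> prod_list l * y \<in> products y"
  unfolding products_def by (intro CollectI exI[of _ l] exI[of _ "[]"]) auto

lemma products_mult: "z \<in> products y \<Longrightarrow> g \<in> GR \<Longrightarrow> z * g \<in> products y"
proof -
  assume "z \<in> products y" "g \<in> GR"
  then obtain l r where "set l \<subseteq> GL" "set r \<subseteq> GR" "z = prod_list l * y * prod_list r"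
    unfolding products_def by blast
  then show ?thesis unfolding products_def using \<open>g \<in> GR\<close>
    by (intro CollectI exI[of _ l] exI[of _ "r @ [g]"]) (auto simp: mult.assoc)
qed

lemma input_Nil: "input [] v = enc None # map (enc \<circ> Some) v"
  by (simp add: input_def)

lemma input_Cons: "input (a # u) v = enc (Some a) # input u v"
  by (simp add: input_def)

text \<open>Reading moves a letter into the product of its track, a guess stays within
  \<open>products\<close>, and a sweep rule is an equation that moves the carry across one cell
  without changing the product.\<close>

lemma sound_step:
  assumes "sound u v z" "zstep delta z z'" shows "sound u v z'"
proof -
  obtain q L R where z: "z = (q, L, R)" by (cases z)
  from assms(2) obtain q' b d where t: "(q, rd R, q', b, d) \<in> delta"
    and z': "z' = (q', zmove d L b (tl R))" unfolding z zstep_def by auto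
  from assms(1) show ?thesis
  proof cases
    case s0
    \<comment> \<open>The separator is always present, so the first cell scanned is not a blank
      beyond the input.\<close>
    have "input u v \<noteq> []" by (simp add: input_def)
    then have "rd (input u v) # tl (input u v) = input u v" by (cases "input u v") auto
    then have "z' = (sy 8 1 1, [], 0 # map (\<lambda>y. cell (1, y)) [] @ input u v)"
      using t z z' s0 by (auto simp: delta_simps zmove_def)
    then show ?thesis using sound.s1[of "[]"] by simp
  next
    case (s1 l)
    consider y where "y \<in> GL" "z' = (sy 8 1 1, [], 0 # map (\<lambda>y. cell (1, y)) (y # l) @ input u v)"
      | "z' = (sy 2 1 1, rev (map cell []) @ [lmark], map (\<lambda>y. cell (1, y)) l @ input u v)"
      using t z z' s1 by (auto simp: delta_simps zmove_def)
    then show ?thesis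
    proof cases
      case 1
      then show ?thesis using s1 sound.s1[of "_ # l"] by (metis insert_subset list.simps(15))
    next
      case 2
      then show ?thesis using s1 sound.s2[of "[]" u u l l v] by simp
    qed
  next
    case (s2 zs u' l' l)
    show ?thesis
    proof (cases l')
      case (Cons y l'')
      then have "z' = (sy 2 1 1, rev (map cell (zs @ [(1, y)])) @ [lmark], map (\<lambda>y. cell (1, y)) l'' @ input u' v)"
        using t z z' s2 by (auto simp: delta_simps zmove_def)
      then show ?thesis using s2 Cons sound.s2[of "zs @ [(1, y)]" u' u l'' l v] by (simp add: mult.assoc)
    next
      case l': Nil
      show ?thesis
      proof (cases u')
        case (Cons a u'')
        then have "z' = (sy 2 1 1, rev (map cell (zs @ [(a, 1)])) @ [lmark], map (\<lambda>y. cell (1, y)) [] @ input u'' v)"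
          using t z z' s2 l' by (auto simp: delta_simps zmove_def input_Cons)
        then show ?thesis using s2 l' Cons sound.s2[of "zs @ [(a, 1)]" u'' u "[]" l v] by (simp add: mult.assoc)
      next
        case Nil
        then have "z' = (sy 3 1 1, rev (map cell (zs @ [(1, 1)])) @ [lmark], map (enc \<circ> Some) v)"
          using t z z' s2 l' by (auto simp: delta_simps zmove_def input_Nil)
        then show ?thesis using s2 l' Nil sound.s3[of "zs @ [(1, 1)]" u v v] products_guess[of l "prod_list v"] by simp
      qed
    qed
  next
    case (s3 zs v')
    show ?thesis
    proof (cases v')
      case (Cons a v'')
      then have "z' = (sy 3 1 1, rev (map cell (zs @ [(1, a)])) @ [lmark], map (enc \<circ> Some) v'')"
        using t z z' s3 by (auto simp: delta_simps zmove_def)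
      then show ?thesis using s3 Cons sound.s3[of "zs @ [(1, a)]" u v'' v] by (simp add: mult.assoc)
    next
      case Nil
      then consider y where "y \<in> GR" "z' = (sy 3 1 1, rev (map cell (zs @ [(1, y)])) @ [lmark], map (enc \<circ> Some) [])"
        | "z' = (sy 5 1 1, rev (map cell zs) @ [lmark], map cell [] @ [rmark])"
        using t z z' s3 by (auto simp: delta_simps zmove_def)
      then show ?thesis
      proof cases
        case (1 y)
        then show ?thesis using s3 Nil sound.s3[of "zs @ [(1, y)]" u "[]" v] products_mult by simp
      next
        case 2
        then show ?thesis using s3 Nil sound.s5[of zs 1 "[]" u 1 v] by simp
      qed
    qed
  next
    case (s4 P c Q d')
    show ?thesis
    proof (cases P rule: rev_cases)
      case Nil
      \<comment> \<open>Here the head is on \<open>lmark\<close>, where the only rule with tag 4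
        requires both carries to be \<open>1\<close>.\<close>
      then have "z' = (sy 5 1 1, rev (map cell []) @ [lmark], map cell Q @ [rmark])" "c = 1" "d' = 1"
        using t z z' s4 by (auto simp: delta_simps zmove_def)
      then show ?thesis using s4 Nil sound.s5[of "[]" 1 Q u 1 v] by simp
    next
      case (snoc P' w)
      then obtain c1 d1 x1 y1 where "z' = onto (sy 4 c1 d1) (rev (map cell P') @ [lmark]) (map cell ((x1, y1) # Q) @ [rmark])"
        "fst w * c = c1 * x1" "snd w * d' = d1 * y1"
        using t z z' s4 by (auto simp: delta_simps zmove_def onto_def)
      moreover from this have "prod_list (map fst P') * c1 * prod_list (map fst ((x1, y1) # Q)) = prod_list u"
        "prod_list (map snd P') * d1 * prod_list (map snd ((x1, y1) # Q)) \<in> products (prod_list v)"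
        using s4 snoc by (simp_all, metis mult.assoc, metis mult.assoc)
      ultimately show ?thesis using sound.s4[of P' c1 "(x1, y1) # Q" u d1 v] by simp
    qed
  next
    case (s5 P c Q d')
    show ?thesis
    proof (cases Q)
      case Nil
      then have "c = 1" "d' = 1" and
        "z' = onto (sy 4 1 1) (rev (map cell P) @ [lmark]) (map cell [] @ [rmark]) \<or>
         z' = onto (sy 6 1 1) (rev (map cell P) @ [lmark]) (map cell [] @ [rmark])"
        using t z z' s5 by (auto simp: delta_simps zmove_def onto_def)
      then show ?thesis using s5 Nil sound.s4[of P 1 "[]" u 1 v] sound.s6[of P "[]" u v] by auto
    next
      case (Cons w Q')
      then obtain c1 d1 x1 y1 where "z' = (sy 5 c1 d1, rev (map cell (P @ [(x1, y1)])) @ [lmark], map cell Q' @ [rmark])"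
        "c * fst w = x1 * c1" "d' * snd w = y1 * d1"
        using t z z' s5 by (auto simp: delta_simps zmove_def)
      moreover from this have "prod_list (map fst (P @ [(x1, y1)])) * c1 * prod_list (map fst Q') = prod_list u"
        "prod_list (map snd (P @ [(x1, y1)])) * d1 * prod_list (map snd Q') \<in> products (prod_list v)"
        using s5 Cons by (simp_all, metis mult.assoc, metis mult.assoc)
      ultimately show ?thesis using sound.s5[of "P @ [(x1, y1)]" c1 Q' u d1 v] by simp
    qed
  next
    case (s6 P Q)
    show ?thesis
    proof (cases P rule: rev_cases)
      case Nil
      then have "\<exists>L R. z' = (sy 7 1 1, L, R)"
        using t z z' s6 by (auto simp: delta_simps zmove_def)
      \<comment> \<open>Now \<open>Q\<close> is the whole tape and its tracks agree, so the two
        products coincide.\<close>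
      then show ?thesis using s6 Nil sound.s7[of u v] by auto
    next
      case (snoc P' w)
      then have "z' = onto (sy 6 1 1) (rev (map cell P') @ [lmark]) (map cell (w # Q) @ [rmark])" "fst w = snd w"
        using t z z' s6 by (auto simp: delta_simps zmove_def onto_def)
      then show ?thesis using s6 snoc sound.s6[of P' "w # Q" u v]
        by (simp add: mult.assoc del: map_eq_conv)
    qed
  next
    case (s7 L' R')
    then show ?thesis using t z by (auto simp: delta_simps)
  qed
qed

lemma accepts_sound:
  assumes "(zstep delta ^^ n) (sy 0 1 1, [], input u v) (sy 7 1 1, L, R)"
  shows "prod_list u \<in> products (prod_list v)"
proof -
  have "(zstep delta ^^ n) z z' \<Longrightarrow> sound u v z \<Longrightarrow> sound u v z'" for z z'
    by (induction n arbitrary: z') (auto elim!: relcomppE intro: sound_step)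
  then have "sound u v (sy 7 1 1, L, R)" using assms sound.s0 by blast
  then show ?thesis by (cases, auto simp: onto_def)
qed


section \<open>Completeness: the accepting run\<close>

lemma run_guess_left:
  "set l \<subseteq> GL \<Longrightarrow> (zstep delta ^^ length l) (sy 8 1 1, [], 0 # R)
     (sy 8 1 1, [], 0 # map (\<lambda>y. cell (1, y)) l @ R)"
\<comment> \<open>The head moves away from the input to the left, so \<open>l\<close> is guessed
  from its last letter to its first.\<close>
proof (induction l arbitrary: R rule: rev_induct)
  case (snoc y l)
  have "zstep delta (sy 8 1 1, [], 0 # R) (onto (sy 8 1 1) [] (cell (1, y) # R))"
    using snoc.prems by (intro zstep_left guess_left) simp
  moreover have "(zstep delta ^^ length l) (sy 8 1 1, [], 0 # cell (1, y) # R)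
      (sy 8 1 1, [], 0 # map (\<lambda>y. cell (1, y)) l @ cell (1, y) # R)"
    using snoc by simp
  ultimately show ?case using relpowp_step[of "zstep delta"] by (fastforce simp: onto_def)
qed simp

lemma run_guess_right:
  "set r \<subseteq> GR \<Longrightarrow> (zstep delta ^^ length r) (sy 3 1 1, L, [])
     (sy 3 1 1, rev (map (\<lambda>y. cell (1, y)) r) @ L, [])"
proof (induction r arbitrary: L)
  case (Cons y r)
  have "zstep delta (sy 3 1 1, L, []) (sy 3 1 1, cell (1, y) # L, [])"
    using Cons.prems by (intro zstep_right_blank guess_right) simp
  moreover have "(zstep delta ^^ length r) (sy 3 1 1, cell (1, y) # L, [])
      (sy 3 1 1, rev (map (\<lambda>y. cell (1, y)) r) @ cell (1, y) # L, [])"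
    using Cons by simp
  ultimately show ?case using relpowp_step[of "zstep delta"] by fastforce
qed simp

text \<open>The configuration between two rounds: the head is on \<open>rmark\<close> with trivial
  carries, and either another round or the final comparison can begin.\<close>

definition base :: "('m \<times> 'm) list \<Rightarrow> zipper" where
  "base zs = (sy 5 1 1, rev (map cell zs) @ [lmark], [rmark])"

text \<open>The separator becomes \<open>(1, 1)\<close>. Filling up with \<open>1\<close> gives both
  tracks the same length, while their products are those of \<open>u\<close> and of
  \<open>l @ v @ r\<close>.\<close>

definition tracks :: "'m list \<Rightarrow> 'm list \<Rightarrow> 'm list \<Rightarrow> 'm list \<Rightarrow> ('m \<times> 'm) list" where
  "tracks l u v r = map (Pair 1) l @ map (\<lambda>a. (a, 1)) u @ (1, 1) # map (Pair 1) (v @ r)"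

text \<open>The word \<open>l\<close> is crossed twice, once when it is guessed and once on the way
  back. The four extra steps are the start, the two markers and the separator.\<close>

lemma run_setup:
  assumes "set u \<subseteq> A" "set v \<subseteq> A" "set l \<subseteq> GL" "set r \<subseteq> GR"
  shows "(zstep delta ^^ (2 * length l + length u + length v + length r + 4))
    (sy 0 1 1, [], input u v) (base (tracks l u v r))"
proof -
  let ?c = "\<lambda>y. cell (1, y)"
  let ?L1 = "rev (map ?c l) @ [lmark]"
  let ?L2 = "rev (map (\<lambda>a. cell (a, 1)) u) @ ?L1"
  let ?L3 = "rev (map ?c v) @ cell (1, 1) # ?L2"
  let ?L4 = "rev (map ?c r) @ ?L3"
  have inp: "input u v = map (enc \<circ> Some) u @ enc None # map (enc \<circ> Some) v"
    by (simp add: input_def)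
  obtain b R where bR: "input u v = b # R" "b = enc None \<or> (\<exists>a\<in>A. b = enc (Some a))"
    using assms(1) unfolding input_def by (cases u) auto
  have 1: "(zstep delta ^^ 1) (sy 0 1 1, [], input u v) (sy 8 1 1, [], 0 # input u v)"
    using zstep_left[OF start[OF bR(2)], of "[]" R] bR unfolding relpowp_1 by (simp add: onto_def)
  have 2: "(zstep delta ^^ length l) (sy 8 1 1, [], 0 # input u v) (sy 8 1 1, [], 0 # map ?c l @ input u v)"
    by (rule run_guess_left) (rule assms)
  have 3: "(zstep delta ^^ 1) (sy 8 1 1, [], 0 # map ?c l @ input u v) (sy 2 1 1, [lmark], map ?c l @ input u v)"
    using zstep_right[OF mark_left] unfolding relpowp_1 by simp
  have 4: "(zstep delta ^^ length l) (sy 2 1 1, [lmark], map ?c l @ input u v) (sy 2 1 1, ?L1, input u v)"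
  proof -
    have "(sy 2 1 1, ?c (l ! i), sy 2 1 1, ?c (l ! i), 1) \<in> delta" if "i < length l" for i
      using that assms(3) by (intro pass_guess) (auto dest: nth_mem)
    then show ?thesis
      using run_right[of "map ?c l" "map ?c l" "\<lambda>_. sy 2 1 1" delta "[lmark]" "input u v"] by simp
  qed
  have 5: "(zstep delta ^^ length u) (sy 2 1 1, ?L1, input u v) (sy 2 1 1, ?L2, enc None # map (enc \<circ> Some) v)"
  proof -
    have "(sy 2 1 1, enc (Some (u ! i)), sy 2 1 1, cell (u ! i, 1), 1) \<in> delta" if "i < length u" for i
      using that assms(1) by (intro read_first) (auto dest: nth_mem)
    then show ?thesis unfolding inp
      using run_right[of "map (enc \<circ> Some) u" "map (\<lambda>a. cell (a, 1)) u" "\<lambda>_. sy 2 1 1" delta ?L1] by simp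
  qed
  have 6: "(zstep delta ^^ 1) (sy 2 1 1, ?L2, enc None # map (enc \<circ> Some) v)
      (sy 3 1 1, cell (1, 1) # ?L2, map (enc \<circ> Some) v)"
    using zstep_right[OF separator] unfolding relpowp_1 by simp
  have 7: "(zstep delta ^^ length v) (sy 3 1 1, cell (1, 1) # ?L2, map (enc \<circ> Some) v) (sy 3 1 1, ?L3, [])"
  proof -
    have "(sy 3 1 1, enc (Some (v ! i)), sy 3 1 1, ?c (v ! i), 1) \<in> delta" if "i < length v" for i
      using that assms(2) by (intro read_second) (auto dest: nth_mem)
    then show ?thesis
      using run_right[of "map (enc \<circ> Some) v" "map ?c v" "\<lambda>_. sy 3 1 1" delta "cell (1, 1) # ?L2" "[]"] by simp
  qed
  have 8: "(zstep delta ^^ length r) (sy 3 1 1, ?L3, []) (sy 3 1 1, ?L4, [])"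
    by (rule run_guess_right) (rule assms)
  have 9: "(zstep delta ^^ 1) (sy 3 1 1, ?L4, []) (sy 5 1 1, ?L4, [rmark])"
    using zstep_stay_blank[OF mark_right] unfolding relpowp_1 by simp
  have "base (tracks l u v r) = (sy 5 1 1, ?L4, [rmark])"
    unfolding base_def tracks_def by (simp add: comp_def)
  moreover have "1 + (length l + (1 + (length l + (length u + (1 + (length v + (length r + 1))))))) =
      2 * length l + length u + length v + length r + 4" by simp
  moreover note relpowp_trans[OF 1 relpowp_trans[OF 2 relpowp_trans[OF 3 relpowp_trans[OF 4 relpowp_trans[OF 5
    relpowp_trans[OF 6 relpowp_trans[OF 7 relpowp_trans[OF 8 9]]]]]]]]
  ultimately show ?thesis by metis
qed

lemma run_round:
  assumes "sweep_round S X1 X1'" "sweep_round S X2 X2'" and len: "length X1 = length X2"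
  shows "(zstep delta ^^ (2 * length X1 + 2)) (base (zip X1 X2)) (base (zip X1' X2'))"
    and "length X1' = length X1" "length X2' = length X2"
proof -
  obtain Y1 Y2 where sw: "sweep S X1 Y1" "sweep S X1' Y1" "sweep S X2 Y2" "sweep S X2' Y2"
    using assms unfolding sweep_round_def by blast
  let ?n = "length X1"
  have n: "length X2 = ?n" "length X1' = ?n" "length X2' = ?n" "length Y1 = ?n" "length Y2 = ?n"
    using sw len unfolding sweep_def by auto
  then show "length X1' = length X1" "length X2' = length X2" by auto
  have inS: "X1 ! i \<in> S" "X2 ! i \<in> S" "Y1 ! i \<in> S" "Y2 ! i \<in> S" "X1' ! i \<in> S" "X2' ! i \<in> S"
    if "i < ?n" for i
    using sw n that unfolding sweep_def by (metis nth_mem subsetD)+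
  \<comment> \<open>\<open>f1\<close> and \<open>f2\<close> are the carries of the pass to the left,
    \<open>g1\<close> and \<open>g2\<close> those of the pass back.\<close>
  obtain f1 where f1: "f1 0 = 1" "f1 ?n = 1" "\<And>i. i \<le> ?n \<Longrightarrow> f1 i \<in> S"
      "\<And>i. i < ?n \<Longrightarrow> X1 ! i * f1 (Suc i) = f1 i * Y1 ! i"
    using sw(1) unfolding sweep_def by auto
  obtain f2 where f2: "f2 0 = 1" "f2 ?n = 1" "\<And>i. i \<le> ?n \<Longrightarrow> f2 i \<in> S"
      "\<And>i. i < ?n \<Longrightarrow> X2 ! i * f2 (Suc i) = f2 i * Y2 ! i"
    using sw(3) n unfolding sweep_def by auto
  obtain g1 where g1: "g1 0 = 1" "g1 ?n = 1" "\<And>i. i \<le> ?n \<Longrightarrow> g1 i \<in> S"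
      "\<And>i. i < ?n \<Longrightarrow> X1' ! i * g1 (Suc i) = g1 i * Y1 ! i"
    using sw(2) n unfolding sweep_def by auto
  obtain g2 where g2: "g2 0 = 1" "g2 ?n = 1" "\<And>i. i \<le> ?n \<Longrightarrow> g2 i \<in> S"
      "\<And>i. i < ?n \<Longrightarrow> X2' ! i * g2 (Suc i) = g2 i * Y2 ! i"
    using sw(4) n unfolding sweep_def by auto
  let ?X = "map cell (zip X1 X2)" and ?Y = "map cell (zip Y1 Y2)" and ?X' = "map cell (zip X1' X2')"
  have 1: "(zstep delta ^^ 1) (base (zip X1 X2)) (onto (sy 4 1 1) (rev ?X @ [lmark]) [rmark])"
    unfolding base_def using zstep_left[OF turn_right] unfolding relpowp_1 by simp
  have 2: "(zstep delta ^^ ?n) (onto (sy 4 1 1) (rev ?X @ [lmark]) [rmark])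
      (onto (sy 4 1 1) [lmark] (?Y @ [rmark]))"
  proof -
    have "(sy 4 (f1 (Suc i)) (f2 (Suc i)), cell (X1 ! i, X2 ! i), sy 4 (f1 i) (f2 i), cell (Y1 ! i, Y2 ! i), -1) \<in> delta"
      if "i < ?n" for i
      using that f1(3)[of i] f1(3)[of "Suc i"] f2(3)[of i] f2(3)[of "Suc i"] inS[of i]
      by (intro sweep_left f1 f2) auto
    then show ?thesis
      using run_left[of ?X ?Y "\<lambda>i. sy 4 (f1 i) (f2 i)" delta "[lmark]" "[rmark]"] n f1(1,2) f2(1,2) by simp
  qed
  have 3: "(zstep delta ^^ 1) (onto (sy 4 1 1) [lmark] (?Y @ [rmark])) (sy 5 1 1, [lmark], ?Y @ [rmark])"
    using zstep_right[OF turn_left] unfolding relpowp_1 by simp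
  have 4: "(zstep delta ^^ ?n) (sy 5 1 1, [lmark], ?Y @ [rmark]) (base (zip X1' X2'))"
  proof -
    have "(sy 5 (g1 i) (g2 i), cell (Y1 ! i, Y2 ! i), sy 5 (g1 (Suc i)) (g2 (Suc i)), cell (X1' ! i, X2' ! i), 1) \<in> delta"
      if "i < ?n" for i
      using that g1(3)[of i] g1(3)[of "Suc i"] g2(3)[of i] g2(3)[of "Suc i"] inS[of i]
      by (intro sweep_right g1(4)[symmetric] g2(4)[symmetric]) auto
    then show ?thesis unfolding base_def
      using run_right[of ?Y ?X' "\<lambda>i. sy 5 (g1 i) (g2 i)" delta "[lmark]" "[rmark]"] n g1(1,2) g2(1,2) by simp
  qed
  from relpowp_trans[OF 1 relpowp_trans[OF 2 relpowp_trans[OF 3 4]]]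
  show "(zstep delta ^^ (2 * length X1 + 2)) (base (zip X1 X2)) (base (zip X1' X2'))"
    by (simp del: relpowp.simps add: mult_2)
qed

text \<open>Both tracks are swept at once, so they have to take the same number \<open>k\<close> of
  rounds.\<close>

lemma run_rounds:
  assumes "(sweep_round S ^^ k) X1 X1'" "(sweep_round S ^^ k) X2 X2'" and len: "length X1 = length X2"
  shows "(zstep delta ^^ (k * (2 * length X1 + 2))) (base (zip X1 X2)) (base (zip X1' X2'))
    \<and> length X1' = length X1 \<and> length X2' = length X2"
  using assms(1,2)
proof (induction k arbitrary: X1' X2')
  case (Suc k)
  from Suc.prems obtain Y1 Y2 where Y: "(sweep_round S ^^ k) X1 Y1" "sweep_round S Y1 X1'"
    "(sweep_round S ^^ k) X2 Y2" "sweep_round S Y2 X2'" by auto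
  note IH = Suc.IH[OF Y(1,3)]
  with run_round[OF Y(2,4)] len
  have "(zstep delta ^^ (2 * length X1 + 2)) (base (zip Y1 Y2)) (base (zip X1' X2'))"
    "length X1' = length X1" "length X2' = length X2" by auto
  with relpowp_trans[OF conjunct1[OF IH] this(1)] show ?case by (simp del: relpowp.simps add: algebra_simps)
qed (use len in auto)

lemma run_check:
  assumes "set X \<subseteq> S"
  shows "\<exists>L R. (zstep delta ^^ (length X + 2)) (base (zip X X)) (sy 7 1 1, L, R)"
proof -
  let ?X = "map cell (zip X X)"
  have 1: "(zstep delta ^^ 1) (base (zip X X)) (onto (sy 6 1 1) (rev ?X @ [lmark]) [rmark])"
    unfolding base_def using zstep_left[OF check_start] unfolding relpowp_1 by simp
  have 2: "(zstep delta ^^ length X) (onto (sy 6 1 1) (rev ?X @ [lmark]) [rmark])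
      (onto (sy 6 1 1) [lmark] (?X @ [rmark]))"
  proof -
    have "(sy 6 1 1, cell (X ! i, X ! i), sy 6 1 1, cell (X ! i, X ! i), -1) \<in> delta" if "i < length X" for i
      using that assms by (intro check) (auto dest: nth_mem)
    then show ?thesis
      using run_left[of ?X ?X "\<lambda>_. sy 6 1 1" delta "[lmark]" "[rmark]"] by simp
  qed
  have 3: "(zstep delta ^^ 1) (onto (sy 6 1 1) [lmark] (?X @ [rmark])) (sy 7 1 1, [], lmark # ?X @ [rmark])"
    using zstep_stay[OF accept] unfolding relpowp_1 by simp
  from relpowp_trans[OF 1 relpowp_trans[OF 2 3]] show ?thesis
    by (auto simp del: relpowp.simps)
qed

text \<open>At most \<open>N\<close> rounds over \<open>N\<close> cells dominate the setup and the
  comparison, which gives the quadratic bound.\<close>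

lemma run_complete:
  assumes "set u \<subseteq> A" "set v \<subseteq> A" "set l \<subseteq> GL" "set r \<subseteq> GR" "set X \<subseteq> S"
    and "(sweep_round S ^^ k) (map fst (tracks l u v r)) X" "(sweep_round S ^^ k) (map snd (tracks l u v r)) X"
    and k: "k \<le> N" and N: "N = length l + length u + length v + length r + 1"
  shows "\<exists>n \<le> 13 * N ^ 2. \<exists>L R. (zstep delta ^^ n) (sy 0 1 1, [], input u v) (sy 7 1 1, L, R)"
proof -
  let ?Z = "tracks l u v r"
  have lZ: "length ?Z = N" unfolding tracks_def N by simp
  have rounds: "(zstep delta ^^ (k * (2 * N + 2))) (base ?Z) (base (zip X X))" "length X = N"
    using run_rounds[OF assms(6,7)] lZ by (auto simp: zip_map_fst_snd)
  obtain L R where chk: "(zstep delta ^^ (N + 2)) (base (zip X X)) (sy 7 1 1, L, R)"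
    using run_check[OF assms(5)] rounds(2) by auto
  let ?n = "2 * length l + length u + length v + length r + 4 + (k * (2 * N + 2) + (N + 2))"
  have "(zstep delta ^^ ?n) (sy 0 1 1, [], input u v) (sy 7 1 1, L, R)"
    by (rule relpowp_trans[OF run_setup[OF assms(1-4)] relpowp_trans[OF rounds(1) chk]])
  moreover have "?n \<le> 13 * N ^ 2"
  proof -
    have "k * (2 * N + 2) \<le> N * (2 * N + 2)" using k by (rule mult_right_mono) simp
    then have "?n \<le> 2 * N + 2 + (N * (2 * N + 2) + (N + 2))" using N by linarith
    also have "\<dots> = 2 * N ^ 2 + 5 * N + 4" by (simp add: power2_eq_square algebra_simps)
    also have "\<dots> \<le> 2 * N ^ 2 + 5 * N ^ 2 + 4 * N ^ 2"
      using N by (intro add_mono) (simp_all add: power2_eq_square)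
    finally show ?thesis by simp
  qed
  ultimately show ?thesis by blast
qed

text \<open>Acceptance implies the relation by \<open>accepts_sound\<close>, whatever the running
  time. The converse is reduced to words: guesses that keep the tape linear in the input, and a
  common word \<open>X\<close> that both tracks reach in no more rounds than there are
  cells.\<close>

theorem rel_in_NP_if_rounds:
  assumes Rel: "\<And>x y. Rel x y \<longleftrightarrow> x \<in> products y"
    and rounds: "\<And>u v. set u \<subseteq> A \<Longrightarrow> set v \<subseteq> A \<Longrightarrow> Rel (prod_list u) (prod_list v) \<Longrightarrow>
      \<exists>l r X n. set l \<subseteq> GL \<and> set r \<subseteq> GR \<and> set X \<subseteq> S \<and>
        (sweep_round S ^^ n) (map fst (tracks l u v r)) X \<and> (sweep_round S ^^ n) (map snd (tracks l u v r)) X \<and>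
        n \<le> length (tracks l u v r) \<and> length (tracks l u v r) \<le> k * (length u + length v + 1)"
  shows "rel_in_NP A Rel"
  unfolding rel_in_NP_def
proof (rule exI[of _ enc], rule exI[of _ delta], rule exI[of _ "sy 0 1 1"], rule exI[of _ "sy 7 1 1"],
    rule exI[of _ "13 * k ^ 2"], rule exI[of _ 2], intro conjI allI impI)
  show "finite delta" by (rule finite_delta)
  show "inj_on enc (insert None (Some ` A))" by (auto simp: inj_on_def)
  show "0 \<notin> enc ` insert None (Some ` A)" by auto
  fix u v assume uv: "set u \<subseteq> A \<and> set v \<subseteq> A"
  let ?b = "13 * k ^ 2 * (length u + length v + 1) ^ 2 + 13 * k ^ 2"
  have "(\<exists>n\<le>?b. \<exists>L R. (zstep delta ^^ n) (sy 0 1 1, [], input u v) (sy 7 1 1, L, R))"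
    if rel: "Rel (prod_list u) (prod_list v)"
  proof -
    obtain l r X m where lr: "set l \<subseteq> GL" "set r \<subseteq> GR" "set X \<subseteq> S"
      "(sweep_round S ^^ m) (map fst (tracks l u v r)) X" "(sweep_round S ^^ m) (map snd (tracks l u v r)) X"
      "m \<le> length (tracks l u v r)" and N: "length (tracks l u v r) \<le> k * (length u + length v + 1)"
      using rounds[OF _ _ rel] uv by blast
    obtain n where "n \<le> 13 * length (tracks l u v r) ^ 2"
      "\<exists>L R. (zstep delta ^^ n) (sy 0 1 1, [], input u v) (sy 7 1 1, L, R)"
      using run_complete[OF _ _ lr refl[THEN trans]] uv by (auto simp: tracks_def)
    moreover have "13 * length (tracks l u v r) ^ 2 \<le> ?b"
      using power_mono[OF N, of 2] unfolding power_mult_distrib mult.assoc by (intro trans_le_add1) simp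
    ultimately show ?thesis using order_trans by blast
  qed
  then show "Rel (prod_list u) (prod_list v) \<longleftrightarrow>
      ntm_accepts_within delta (sy 0 1 1) (sy 7 1 1) (map enc (map Some u @ [None] @ map Some v)) ?b"
    unfolding accepts_within_iff using accepts_sound Rel unfolding input_def by blast
qed

end

section \<open>Geodesic words in a hyperbolic Cayley graph\<close>

lemma prod_list_eq_1: "set w \<subseteq> {1} \<Longrightarrow> prod_list w = (1::'m::monoid_mult)"
  by (induction w) auto

lemma L_le_iff: "L_le x y \<longleftrightarrow> (\<exists>m. x = m * y)"
proof
  assume "L_le x y"
  then have "1 * x \<in> range (\<lambda>m. m * y)" unfolding L_le_def by blast
  then show "\<exists>m. x = m * y" by auto
qed (auto simp: L_le_def simp flip: mult.assoc)

lemma R_le_iff: "R_le x y \<longleftrightarrow> (\<exists>m. x = y * m)"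
proof
  assume "R_le x y"
  then have "x * 1 \<in> range (\<lambda>m. y * m)" unfolding R_le_def by blast
  then show "\<exists>m. x = y * m" by auto
qed (auto simp: R_le_def mult.assoc)

text \<open>Preimages compose along a word, so the bounds for its letters multiply. Passing to
  arbitrary elements frees the hypothesis from \<open>A\<close>, since hyperbolicity may hold for
  another generating set.\<close>

lemma bounded_indegree_all:
  fixes A :: "'m::monoid_mult set" and s :: 'm
  assumes "bounded_indegree A" "generates A"
  shows "\<exists>\<alpha>::nat. \<forall>y. finite {x. x * s = y} \<and> card {x. x * s = y} \<le> \<alpha>"
proof -
  obtain \<beta> where \<beta>: "\<And>a y. a \<in> A \<Longrightarrow> finite {x. x * a = y} \<and> card {x. x * a = y} \<le> \<beta>"
    using assms(1) unfolding bounded_indegree_def by blast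
  have "set w \<subseteq> A \<Longrightarrow> \<exists>\<alpha>::nat. \<forall>y. finite {x. x * prod_list w = y} \<and> card {x. x * prod_list w = y} \<le> \<alpha>" for w
  proof (induction w)
    case (Cons a w)
    then obtain \<alpha> where \<alpha>: "\<And>y. finite {x. x * prod_list w = y} \<and> card {x. x * prod_list w = y} \<le> \<alpha>" by auto
    have "finite {x. x * prod_list (a # w) = y} \<and> card {x. x * prod_list (a # w) = y} \<le> \<alpha> * \<beta>" for y
    proof -
      let ?Z = "{z. z * prod_list w = y}"
      have eq: "{x. x * prod_list (a # w) = y} = (\<Union>z\<in>?Z. {x. x * a = z})"
        by (auto simp: mult.assoc)
      have "card (\<Union>z\<in>?Z. {x. x * a = z}) \<le> (\<Sum>z\<in>?Z. card {x. x * a = z})"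
        using \<alpha> by (intro card_UN_le) auto
      also have "\<dots> \<le> (\<Sum>z\<in>?Z. \<beta>)" using \<beta> Cons.prems by (intro sum_mono) auto
      also have "\<dots> \<le> \<alpha> * \<beta>" using \<alpha>[of y] by simp
      finally show ?thesis unfolding eq using \<alpha> \<beta> Cons.prems by auto
    qed
    then show ?case by blast
  qed (auto intro!: exI[of _ 1])
  moreover obtain w where "set w \<subseteq> A" "prod_list w = s"
    using assms(2) unfolding generates_def by blast
  ultimately show ?thesis by blast
qed

text \<open>The bound in \<open>indegree\<close> may depend on \<open>s\<close>; uniformity over a
  ball follows later from the finiteness of the ball.\<close>

locale hyperbolic_cayley =
  fixes B :: "'m::monoid_mult set" and \<delta> :: nat
  assumes finite_B: "finite B"
    and gen: "generates B"
    and lcancel: "\<And>a b c :: 'm. a * b = a * c \<Longrightarrow> b = c"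
    and hyp: "strongly_hyperbolic_cayley B \<delta>"
    and indegree: "\<And>s::'m. \<exists>\<alpha>::nat. \<forall>y. finite {x. x * s = y} \<and> card {x. x * s = y} \<le> \<alpha>"
begin

section \<open>Word length and geodesic words\<close>

lemma cancel [simp]: "a * b = a * c \<longleftrightarrow> b = (c::'m)"
  using lcancel by blast

text \<open>This is the distance from \<open>1\<close> to \<open>g\<close>, and by left
  cancellativity also that from any \<open>x\<close> to \<open>x * g\<close>.\<close>

definition len :: "'m \<Rightarrow> nat" where
  "len g = (LEAST n. \<exists>w. set w \<subseteq> B \<and> length w = n \<and> prod_list w = g)"

definition geo :: "'m list \<Rightarrow> bool" where
  "geo w \<longleftrightarrow> set w \<subseteq> B \<and> length w = len (prod_list w)"

definition gword :: "'m \<Rightarrow> 'm list" where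
  "gword g = (SOME w. geo w \<and> prod_list w = g)"

lemma len_le: "set w \<subseteq> B \<Longrightarrow> len (prod_list w) \<le> length w"
  unfolding len_def by (rule Least_le) blast

lemma gword: "geo (gword g)" "prod_list (gword g) = g"
proof -
  obtain w where "set w \<subseteq> B" "prod_list w = g"
    using gen unfolding generates_def by blast
  then have "\<exists>n w. set w \<subseteq> B \<and> length w = n \<and> prod_list w = g" by blast
  then have "\<exists>w. set w \<subseteq> B \<and> length w = len g \<and> prod_list w = g"
    unfolding len_def by (rule LeastI_ex)
  then have "\<exists>w. geo w \<and> prod_list w = g" unfolding geo_def by blast
  then have "geo (gword g) \<and> prod_list (gword g) = g"
    unfolding gword_def by (rule someI_ex)
  then show "geo (gword g)" "prod_list (gword g) = g" by auto
qed

lemma length_gword [simp]: "length (gword g) = len g"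
  using gword[of g] unfolding geo_def by simp

lemma set_gword: "set (gword g) \<subseteq> B"
  using gword[of g] unfolding geo_def by simp

lemma len_mult: "len (g * h) \<le> len g + len h"
  using len_le[of "gword g @ gword h"] set_gword[of g] set_gword[of h] gword(2)[of g] gword(2)[of h]
  by simp

lemma len_1 [simp]: "len 1 = 0"
  using len_le[of "[]"] by simp

lemma len_gen: "b \<in> B \<Longrightarrow> len b \<le> 1"
  using len_le[of "[b]"] by simp

lemma len_prod_list: "(\<And>a. a \<in> set w \<Longrightarrow> len a \<le> k) \<Longrightarrow> len (prod_list w) \<le> k * length w"
proof (induction w)
  case (Cons a w)
  have "len (a * prod_list w) \<le> len a + len (prod_list w)" by (rule len_mult)
  also have "\<dots> \<le> k + k * length w" using Cons by (intro add_mono) auto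
  finally show ?case by simp
qed simp

lemma prod_take_drop: "prod_list (take i w) * prod_list (drop i w) = prod_list (w::'m list)"
  by (metis append_take_drop_id prod_list.append)

text \<open>Neither factor can be shortened, since \<open>len\<close> is subadditive and the whole
  word attains the sum of the two lengths.\<close>

lemma geo_append:
  assumes "geo (u @ v)" shows "geo u" "geo v"
proof -
  have uv: "set u \<subseteq> B" "set v \<subseteq> B" "length u + length v = len (prod_list u * prod_list v)"
    using assms unfolding geo_def by auto
  then show "geo u" "geo v"
    using len_mult[of "prod_list u" "prod_list v"] len_le[of u] len_le[of v] unfolding geo_def by auto
qed

lemma geo_take: "geo w \<Longrightarrow> geo (take i w)"
  using geo_append[of "take i w" "drop i w"] by simp

lemma geo_drop: "geo w \<Longrightarrow> geo (drop i w)"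
  using geo_append[of "take i w" "drop i w"] by simp

lemma len_take: "geo w \<Longrightarrow> len (prod_list (take i w)) = min (length w) i"
  using geo_take[of w i] unfolding geo_def by simp

lemma prod_take_split:
  "i \<le> j \<Longrightarrow> prod_list (take j w) = prod_list (take i w) * prod_list (take (j - i) (drop i (w::'m list)))"
  by (metis prod_list.append take_add le_add_diff_inverse)

lemma len_segment: "geo w \<Longrightarrow> len (prod_list (take (j - i) (drop i w))) \<le> j - i"
  using len_take[OF geo_drop] by simp

text \<open>Distinct prefixes of a geodesic word have distinct \<open>len\<close>. Hence counting
  vertices measures the length of a geodesic.\<close>

lemma inj_on_prefixes:
  assumes "geo w" shows "inj_on (\<lambda>i. prod_list (take i w)) {..length w}"
proof (rule inj_onI)
  fix i j assume "i \<in> {..length w}" "j \<in> {..length w}"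
    and "prod_list (take i w) = prod_list (take j w)"
  moreover from this(3) have "min (length w) i = min (length w) j"
    using len_take[OF assms, of i] len_take[OF assms, of j] by metis
  ultimately show "i = j" by simp
qed

definition gball :: "nat \<Rightarrow> 'm set" where
  "gball k = {g. len g \<le> k}"

lemma gball_iff [simp]: "g \<in> gball k \<longleftrightarrow> len g \<le> k"
  by (simp add: gball_def)

lemma finite_gball: "finite (gball k)"
proof (rule finite_subset)
  show "gball k \<subseteq> prod_list ` {w. set w \<subseteq> B \<and> length w \<le> k}"
  proof
    fix g assume "g \<in> gball k"
    then show "g \<in> prod_list ` {w. set w \<subseteq> B \<and> length w \<le> k}"
      using set_gword[of g] gword(2)[of g] by (intro image_eqI[of _ _ "gword g"]) auto
  qed
  show "finite (prod_list ` {w. set w \<subseteq> B \<and> length w \<le> k})"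
    using finite_lists_length_le[OF finite_B] by simp
qed

section \<open>Directed paths and thin triangles in terms of words\<close>

definition wpath :: "'m \<Rightarrow> 'm list \<Rightarrow> 'm list" where
  "wpath x w = map (\<lambda>i. x * prod_list (take i w)) [0..<Suc (length w)]"

lemma set_wpath: "set (wpath x w) = {x * prod_list (take i w) |i. i \<le> length w}"
  unfolding wpath_def by (auto simp: image_iff less_Suc_eq_le simp del: upt_Suc)

lemma hd_wpath [simp]: "hd (wpath x w) = x"
  unfolding wpath_def by (simp add: hd_map del: upt_Suc)

lemma last_wpath [simp]: "last (wpath x w) = x * prod_list w"
  unfolding wpath_def by simp

lemma length_wpath [simp]: "length (wpath x w) = Suc (length w)"
  unfolding wpath_def by simp

lemma cpath_wpath:
  assumes "set w \<subseteq> B" shows "cpath B (wpath x w)"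
proof -
  have "cedge B (wpath x w ! i) (wpath x w ! Suc i)" if "i < length w" for i
  proof -
    have "wpath x w ! i = x * prod_list (take i w)"
      "wpath x w ! Suc i = x * prod_list (take i w) * w ! i"
      using that unfolding wpath_def
      by (simp_all add: take_Suc_conv_app_nth mult.assoc del: upt_Suc)
    moreover have "w ! i \<in> B" using that assms by (auto dest: nth_mem)
    ultimately show ?thesis unfolding cedge_def by auto
  qed
  then show ?thesis unfolding cpath_def using length_wpath[of x w] by fastforce
qed

lemma cpath_word:
  "cpath B p \<Longrightarrow> \<exists>w. set w \<subseteq> B \<and> length w = length p - 1 \<and> hd p * prod_list w = last p"
proof (induction p)
  case Nil then show ?case by (simp add: cpath_def)
next
  case (Cons x p)
  show ?case
  proof (cases p)
    case Nil
    then show ?thesis by simp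
  next
    case (Cons y p')
    have step: "\<And>i. Suc i < length (x # p) \<Longrightarrow> cedge B ((x # p) ! i) ((x # p) ! Suc i)"
      using Cons.prems by (simp add: cpath_def)
    have "cpath B p" unfolding cpath_def using step[of "Suc _"] Cons by auto
    then obtain w where w: "set w \<subseteq> B" "length w = length p - 1" "hd p * prod_list w = last p"
      using Cons.IH by blast
    from step[of 0] Cons obtain b where "b \<in> B" "x * b = hd p"
      unfolding cedge_def by auto
    then show ?thesis using w Cons
      by (intro exI[of _ "b # w"]) (auto simp flip: mult.assoc)
  qed
qed

text \<open>Paths are read as words and words as paths. This turns each ball condition into a
  factorisation by a short element.\<close>

lemma cdist_le_iff: "cdist B x y \<le> enat n \<longleftrightarrow> (\<exists>s. x * s = y \<and> len s \<le> n)"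
proof
  assume le: "cdist B x y \<le> enat n"
  have "\<exists>p. cpath B p \<and> hd p = x \<and> last p = y \<and> length p - 1 \<le> n"
  proof (rule ccontr)
    assume "\<not> ?thesis"
    \<comment> \<open>If every path from \<open>x\<close> to \<open>y\<close> is longer than
      \<open>n\<close>, then \<open>Suc n\<close> is a lower bound of the infimum.\<close>
    then have "enat (Suc n) \<le> cdist B x y"
      unfolding cdist_def by (intro INF_greatest) (auto simp: not_le Suc_le_eq)
    with le have "enat (Suc n) \<le> enat n" by (rule order_trans[rotated])
    then show False by simp
  qed
  then obtain p where p: "cpath B p" "hd p = x" "last p = y" "length p - 1 \<le> n" by blast
  then obtain w where "set w \<subseteq> B" "length w \<le> n" "x * prod_list w = y"
    using cpath_word[of p] by auto
  then show "\<exists>s. x * s = y \<and> len s \<le> n" using len_le[of w] by force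
next
  assume "\<exists>s. x * s = y \<and> len s \<le> n"
  then obtain s where s: "x * s = y" "len s \<le> n" by blast
  have "cdist B x y \<le> enat (length (wpath x (gword s)) - 1)"
    unfolding cdist_def using s cpath_wpath[OF set_gword] gword(2)[of s] by (intro INF_lower) auto
  also have "\<dots> \<le> enat n" using s by simp
  finally show "cdist B x y \<le> enat n" .
qed

text \<open>By left cancellativity \<open>prod_list w\<close> is the only element leading from
  \<open>x\<close> to \<open>x * prod_list w\<close>, so no path between them is shorter than
  \<open>w\<close>.\<close>

lemma geodesic_wpath:
  assumes "geo w" shows "geodesic B (wpath x w)"
proof -
  let ?n = "length w" and ?y = "x * prod_list w"
  have "cdist B x ?y \<le> enat ?n"
    using assms cdist_le_iff[of x ?y ?n] unfolding geo_def by auto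
  then obtain m where m: "cdist B x ?y = enat m" "m \<le> ?n"
    by (cases "cdist B x ?y") auto
  have "cdist B x ?y \<le> enat m" using m by simp
  then have "len (prod_list w) \<le> m" unfolding cdist_le_iff by auto
  then have "cdist B x ?y = enat ?n" using m assms unfolding geo_def by simp
  then show ?thesis unfolding geodesic_def using assms cpath_wpath unfolding geo_def by simp
qed

text \<open>The triangle starts at \<open>1\<close> and has sides labelled \<open>p\<close>,
  \<open>q\<close>, \<open>r\<close>. Out-balls become short right factors of prefixes of the other
  side, in-balls short elements leading to that side.\<close>

lemma thin:
  assumes p: "geo p" and q: "geo q" and r: "geo r" and eq: "prod_list p * prod_list q = prod_list r"
  shows thin_third: "i \<le> length r \<Longrightarrow>
      (\<exists>j s. j \<le> length p \<and> len s \<le> \<delta> \<and> prod_list (take j p) * s = prod_list (take i r)) \<or>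
      (\<exists>k s. k \<le> length q \<and> len s \<le> \<delta> \<and> prod_list (take i r) * s = prod_list p * prod_list (take k q))"
    and thin_first: "j \<le> length p \<Longrightarrow>
      (\<exists>i s. i \<le> length r \<and> len s \<le> \<delta> \<and> prod_list (take i r) * s = prod_list (take j p)) \<or>
      (\<exists>k s. k \<le> length q \<and> len s \<le> \<delta> \<and> prod_list (take j p) * s = prod_list p * prod_list (take k q))"
    and thin_second: "k \<le> length q \<Longrightarrow>
      (\<exists>j s. j \<le> length p \<and> len s \<le> \<delta> \<and> prod_list (take j p) * s = prod_list p * prod_list (take k q)) \<or>
      (\<exists>i s. i \<le> length r \<and> len s \<le> \<delta> \<and> prod_list p * prod_list (take k q) * s = prod_list (take i r))"
proof -
  have "geodesic_triangle B (wpath 1 p) (wpath (prod_list p) q) (wpath 1 r)"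
    unfolding geodesic_triangle_def using assms geodesic_wpath by simp
  then have t: "thin_triangle B \<delta> (wpath 1 p) (wpath (prod_list p) q) (wpath 1 r)"
    using hyp unfolding strongly_hyperbolic_cayley_def by blast
  note t = t[unfolded thin_triangle_def in_out_ball_def in_in_ball_def cdist_le_iff set_wpath]
  show "i \<le> length r \<Longrightarrow>
      (\<exists>j s. j \<le> length p \<and> len s \<le> \<delta> \<and> prod_list (take j p) * s = prod_list (take i r)) \<or>
      (\<exists>k s. k \<le> length q \<and> len s \<le> \<delta> \<and> prod_list (take i r) * s = prod_list p * prod_list (take k q))"
    using t[THEN conjunct1, THEN bspec, of "prod_list (take i r)"] by fastforce
  show "j \<le> length p \<Longrightarrow>
      (\<exists>i s. i \<le> length r \<and> len s \<le> \<delta> \<and> prod_list (take i r) * s = prod_list (take j p)) \<or>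
      (\<exists>k s. k \<le> length q \<and> len s \<le> \<delta> \<and> prod_list (take j p) * s = prod_list p * prod_list (take k q))"
    using t[THEN conjunct2, THEN conjunct1, THEN bspec, of "prod_list (take j p)"] by fastforce
  show "k \<le> length q \<Longrightarrow>
      (\<exists>j s. j \<le> length p \<and> len s \<le> \<delta> \<and> prod_list (take j p) * s = prod_list p * prod_list (take k q)) \<or>
      (\<exists>i s. i \<le> length r \<and> len s \<le> \<delta> \<and> prod_list p * prod_list (take k q) * s = prod_list (take i r))"
    using t[THEN conjunct2, THEN conjunct2, THEN bspec, of "prod_list p * prod_list (take k q)"] by fastforce
qed

section \<open>Uniformly finite balls and fellow travelling of geodesics\<close>

lemma in_ball_bounded: "\<exists>D. \<forall>y. finite {x. \<exists>s. len s \<le> k \<and> x * s = y} \<and>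
    card {x. \<exists>s. len s \<le> k \<and> x * s = y} \<le> D"
proof -
  have "\<forall>s::'m. \<exists>\<alpha>::nat. \<forall>y. finite {x. x * s = y} \<and> card {x. x * s = y} \<le> \<alpha>"
    using indegree by blast
  from choice[OF this] obtain \<alpha> :: "'m \<Rightarrow> nat"
    where \<alpha>: "\<And>s y. finite {x. x * s = y} \<and> card {x. x * s = y} \<le> \<alpha> s" by blast
  \<comment> \<open>An in-ball is a union of preimages under right multiplication by the finitely
    many elements of \<open>gball k\<close>, so the bounds add up.\<close>
  have eq: "{x. \<exists>s. len s \<le> k \<and> x * s = y} = (\<Union>s\<in>gball k. {x. x * s = y})" for y
    by auto
  have "card (\<Union>s\<in>gball k. {x. x * s = y}) \<le> (\<Sum>s\<in>gball k. \<alpha> s)" for y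
    by (rule order_trans[OF card_UN_le[OF finite_gball]]) (use \<alpha> in \<open>auto intro: sum_mono\<close>)
  then show ?thesis unfolding eq using \<alpha> finite_gball by (intro exI[of _ "\<Sum>s\<in>gball k. \<alpha> s"]) auto
qed

text \<open>From \<open>w * t = 1\<close>, cancelling \<open>w\<close> in
  \<open>w * (t * w) = w\<close> gives \<open>t * w = 1\<close>. So a left inverse of
  \<open>t\<close> is two-sided and unique, and \<open>t\<close> ranges over a finite ball.\<close>

lemma unit_len_bounded: "\<exists>D. \<forall>w t. w * t = 1 \<and> len t \<le> k \<longrightarrow> len w \<le> D"
proof -
  define inv where "inv t = (SOME w. w * t = 1)" for t :: 'm
  have inv: "w = inv t" if "w * t = 1" for w t :: 'm
  proof -
    have "inv t * t = 1" unfolding inv_def by (rule someI[of _ w]) (rule that)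
    have tw: "t * w = 1" using lcancel[of w "t * w" 1] that by (simp flip: mult.assoc)
    have "inv t = inv t * (t * w)" by (simp add: tw)
    also have "\<dots> = w" using \<open>inv t * t = 1\<close> by (simp flip: mult.assoc)
    finally show ?thesis by simp
  qed
  \<comment> \<open>Where \<open>t\<close> has no left inverse, \<open>inv t\<close> is an arbitrary
    element, which can only enlarge the maximum.\<close>
  have "len (inv t) \<le> Max ((len \<circ> inv) ` gball k)" if "len t \<le> k" for t
    by (rule Max_ge) (use that finite_gball in auto)
  then show ?thesis using inv by metis
qed

text \<open>A triangle whose second side is short: the vertices of the first side lying within the in-ball
  of that side are boundedly many, so every other vertex of the first side is near a vertex of the third.\<close>
lemma near_third_side:
  "\<exists>D. \<forall>p r a. geo p \<and> geo r \<and> len a \<le> k \<and> prod_list p * a = prod_list r \<longrightarrow>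
     (\<forall>j\<le>length p. \<exists>j'\<le>j. j \<le> j' + D \<and>
        (\<exists>i s. i \<le> length r \<and> len s \<le> \<delta> \<and> prod_list (take i r) * s = prod_list (take j' p)))"
proof -
  obtain D where D: "\<And>y. finite {x. \<exists>s. len s \<le> \<delta> + k \<and> x * s = y}"
      "\<And>y. card {x. \<exists>s. len s \<le> \<delta> + k \<and> x * s = y} \<le> D"
    using in_ball_bounded by blast
  show ?thesis
  proof (rule exI[of _ D], intro allI impI)
    fix p r a j
    assume A: "geo p \<and> geo r \<and> len a \<le> k \<and> prod_list p * a = prod_list r" and j: "j \<le> length p"
    let ?near = "\<lambda>j'. \<exists>i s. i \<le> length r \<and> len s \<le> \<delta> \<and> prod_list (take i r) * s = prod_list (take j' p)"
    let ?X = "{x. \<exists>s. len s \<le> \<delta> + k \<and> x * s = prod_list r}"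
    show "\<exists>j'\<le>j. j \<le> j' + D \<and> ?near j'"
    proof (rule ccontr)
      assume no: "\<not> ?thesis"
      \<comment> \<open>Both sides start at \<open>1\<close>, so a failure forces
        \<open>D < j\<close>, and the \<open>D + 1\<close> distinct vertices from
        \<open>j - D\<close> to \<open>j\<close> would all lie in \<open>?X\<close>.\<close>
      have "?near 0" by (intro exI[of _ 0] exI[of _ 1]) auto
      with no have "D < j" by force
      have far: "prod_list (take j' p) \<in> ?X" if "j' \<in> {j - D..j}" for j'
      proof -
        have "\<not> ?near j'" using no that by auto
        moreover have "j' \<le> length p" using that j by auto
        ultimately obtain l s where "l \<le> len a" and s: "len s \<le> \<delta>"
          and e: "prod_list (take j' p) * s = prod_list p * prod_list (take l (gword a))"
          using thin_first[of p "gword a" r j'] A gword by auto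
        \<comment> \<open>The way to the vertex met on the short side is continued along that side
          to its end.\<close>
        let ?t = "s * prod_list (drop l (gword a))"
        have "prod_list (take j' p) * ?t = prod_list p * prod_list (gword a)"
          using e prod_take_drop[of l "gword a"] by (metis mult.assoc)
        moreover have "len ?t \<le> \<delta> + k"
          using len_mult[of s "prod_list (drop l (gword a))"] s
            geo_drop[OF gword(1), of l a] A unfolding geo_def by auto
        ultimately show ?thesis using A gword(2) by auto
      qed
      have "card {j - D..j} = card ((\<lambda>i. prod_list (take i p)) ` {j - D..j})"
        using inj_on_prefixes[of p] A j by (intro card_image[symmetric]) (auto elim: inj_on_subset)
      also have "\<dots> \<le> card ?X" using far D(1) by (intro card_mono) auto
      also have "\<dots> \<le> D" by (rule D(2))
      finally show False using \<open>D < j\<close> by simp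
    qed
  qed
qed

text \<open>Thinness links the prefix of \<open>r\<close> at \<open>i\<close> to a prefix of
  \<open>p\<close> at some \<open>j\<close>, and lengths give \<open>i \<le> j + \<delta>\<close>.
  That \<open>j\<close> is not far ahead of \<open>i\<close> needs the way back from
  \<open>p\<close> to \<open>r\<close>: if it ends at a later vertex of \<open>r\<close>, the
  segment of \<open>r\<close> in between has a short right inverse and is itself short. The end of
  \<open>r\<close>, where the vertex may be near \<open>a\<close> instead, is treated
  separately.\<close>

lemma fellow_travel:
  "\<exists>C K. \<kappa> \<le> C \<and> (\<forall>p r a. geo p \<and> geo r \<and> len a \<le> \<kappa> \<and> prod_list p * a = prod_list r \<longrightarrow>
      length p \<le> length r + K \<and>
      (\<forall>i\<le>length r. \<exists>c. len c \<le> K \<and> prod_list (take (i - C) p) * c = prod_list (take i r)))"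
proof -
  obtain D where D: "\<And>p r a j. geo p \<Longrightarrow> geo r \<Longrightarrow> len a \<le> \<kappa> \<Longrightarrow> prod_list p * a = prod_list r \<Longrightarrow>
     j \<le> length p \<Longrightarrow> \<exists>j'\<le>j. j \<le> j' + D \<and>
        (\<exists>i s. i \<le> length r \<and> len s \<le> \<delta> \<and> prod_list (take i r) * s = prod_list (take j' p))"
    using near_third_side[of \<kappa>] by metis
  obtain U where U: "\<And>w t. w * t = 1 \<Longrightarrow> len t \<le> \<delta> + D + \<delta> \<Longrightarrow> len w \<le> U"
    using unit_len_bounded by meson
  \<comment> \<open>\<open>C\<close> covers the last \<open>\<delta> + \<kappa> + 1\<close> letters
    of \<open>r\<close> and the delay \<open>\<delta>\<close>. \<open>K0\<close> comes from \<open>j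
    \<le> j' + D \<le> i' + \<delta> + D \<le> i + U + \<delta> + D\<close>, counted from
    \<open>i - \<delta>\<close>, together with the length of \<open>s\<close>. \<open>K\<close> adds
    a filling segment of \<open>p\<close> and one of \<open>r\<close>.\<close>
  define C where "C = 2 * \<delta> + \<kappa> + 1"
  define K0 where "K0 = U + D + 3 * \<delta>"
  define K where "K = C + K0 + C"
  have main: "length p \<le> length r + K \<and>
      (\<forall>i\<le>length r. \<exists>c. len c \<le> K \<and> prod_list (take (i - C) p) * c = prod_list (take i r))"
    if p: "geo p" and r: "geo r" and a: "len a \<le> \<kappa>" and eq: "prod_list p * a = prod_list r" for p r a
  proof -
    note D = D[OF p r a eq]
    have near: "j' \<le> i + \<delta>" if "j' \<le> length p" "i \<le> length r" "len s \<le> \<delta>"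
      "prod_list (take i r) * s = prod_list (take j' p)" for i j' s
      using len_mult[of "prod_list (take i r)" s] that len_take[OF p, of j'] len_take[OF r, of i] by simp
    have near': "i \<le> j + \<delta>" if "j \<le> length p" "i \<le> length r" "len s \<le> \<delta>"
      "prod_list (take j p) * s = prod_list (take i r)" for i j s
      using len_mult[of "prod_list (take j p)" s] that len_take[OF p, of j] len_take[OF r, of i] by simp
    have "length p \<le> length r + K"
    proof -
      obtain j' i s where "j' \<le> length p" "length p \<le> j' + D" "i \<le> length r" "len s \<le> \<delta>"
        "prod_list (take i r) * s = prod_list (take j' p)"
        using D[of "length p"] by blast
      then show ?thesis using near[of j' i s] unfolding K_def K0_def by simp
    qed
    moreover
    \<comment> \<open>Far from the end of \<open>r\<close> the vertex cannot be near the short side,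
      for then the rest of \<open>r\<close> would have length at most
      \<open>\<delta> + \<kappa>\<close>. The case \<open>i = 0\<close> is included because
      \<open>i1\<close> below is \<open>0\<close> when \<open>r\<close> is short.\<close>
    have early: "\<exists>c. len c \<le> K0 \<and> prod_list (take (i - \<delta>) p) * c = prod_list (take i r)"
      if i: "i = 0 \<or> i + \<delta> + \<kappa> < length r" for i
    proof (cases "i = 0")
      case True
      then show ?thesis by (intro exI[of _ 1]) simp
    next
      case False
      then have i: "i + \<delta> + \<kappa> < length r" using i by simp
      have "\<not> (\<exists>k s. k \<le> length (gword a) \<and> len s \<le> \<delta> \<and>
          prod_list (take i r) * s = prod_list p * prod_list (take k (gword a)))"
      proof
        assume "\<exists>k s. k \<le> length (gword a) \<and> len s \<le> \<delta> \<and>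
          prod_list (take i r) * s = prod_list p * prod_list (take k (gword a))"
        then obtain k s where k: "k \<le> len a" and s: "len s \<le> \<delta>"
          and e: "prod_list (take i r) * s = prod_list p * prod_list (take k (gword a))" by auto
        let ?t = "s * prod_list (drop k (gword a))"
        have "prod_list (take i r) * ?t = prod_list p * prod_list (gword a)"
          using e prod_take_drop[of k "gword a"] by (metis mult.assoc)
        then have "prod_list (take i r) * ?t = prod_list (take i r) * prod_list (drop i r)"
          using eq gword(2) prod_take_drop[of i r] by simp
        then have "?t = prod_list (drop i r)" by simp
        moreover have "len ?t \<le> \<delta> + \<kappa>"
          using len_mult[of s "prod_list (drop k (gword a))"] s
            geo_drop[OF gword(1), of k a] a unfolding geo_def by auto
        moreover have "len (prod_list (drop i r)) = length r - i"
          using geo_drop[OF r, of i] unfolding geo_def by simp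
        ultimately show False using i by simp
      qed
      then obtain j s where j: "j \<le> length p" and s: "len s \<le> \<delta>"
        and js: "prod_list (take j p) * s = prod_list (take i r)"
        using thin_third[of p "gword a" r i] i p r eq gword by auto
      obtain j' i' s' where j': "j' \<le> j" "j \<le> j' + D" and i': "i' \<le> length r" and s': "len s' \<le> \<delta>"
        and js': "prod_list (take i' r) * s' = prod_list (take j' p)"
        using D[OF j] by blast
      have "j' \<le> i' + \<delta>" using near[OF _ i' s' js'] j j' by simp
      have "i \<le> j + \<delta>" using near'[OF j _ s js] i by simp
      have "i' \<le> i + U"
      proof (cases "i' \<le> i")
        case False
        \<comment> \<open>The short way back from the vertex at i' to the vertex at i makes the segment between them a unit.\<close>
        let ?w = "prod_list (take (i' - i) (drop i r))"
        let ?t = "s' * prod_list (take (j - j') (drop j' p)) * s"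
        have "prod_list (take i r) * (?w * ?t) = prod_list (take i' r) * ?t"
          using prod_take_split[of i i' r] False by (simp add: mult.assoc)
        also have "\<dots> = prod_list (take j p) * s"
          using js' prod_take_split[of j' j p] j' by (metis mult.assoc)
        also have "\<dots> = prod_list (take i r) * 1" using js by simp
        finally have "?w * ?t = 1" by (rule lcancel)
        moreover have "len ?t \<le> \<delta> + D + \<delta>"
          using len_mult[of "s' * prod_list (take (j - j') (drop j' p))" s]
            len_mult[of s' "prod_list (take (j - j') (drop j' p))"] s s' len_segment[OF p, of j j'] j'
          by linarith
        ultimately have "len ?w \<le> U" by (rule U)
        moreover have "len ?w = i' - i"
          using len_take[OF geo_drop[OF r]] i' by simp
        ultimately show ?thesis by simp
      qed simp
      have ij: "i - \<delta> \<le> j" using \<open>i \<le> j + \<delta>\<close> by simp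
      let ?c = "prod_list (take (j - (i - \<delta>)) (drop (i - \<delta>) p)) * s"
      have "len ?c \<le> K0"
        using len_mult[of "prod_list (take (j - (i - \<delta>)) (drop (i - \<delta>) p))" s] s
          len_segment[OF p, of j "i - \<delta>"] \<open>i' \<le> i + U\<close> \<open>j' \<le> i' + \<delta>\<close> j'
        unfolding K0_def by linarith
      moreover have "prod_list (take (i - \<delta>) p) * ?c = prod_list (take i r)"
        using js prod_take_split[OF ij, of p] by (simp add: mult.assoc)
      ultimately show ?thesis by blast
    qed
    have "\<exists>c. len c \<le> K \<and> prod_list (take (i - C) p) * c = prod_list (take i r)" if i: "i \<le> length r" for i
    proof -
      \<comment> \<open>The index is moved back out of the last letters of \<open>r\<close>, where
        \<open>early\<close> applies; the segments \<open>?x\<close> of \<open>p\<close> and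
        \<open>?y\<close> of \<open>r\<close> make up for it.\<close>
      define i1 where "i1 = min i (length r - (\<delta> + \<kappa> + 1))"
      have i1: "i1 = 0 \<or> i1 + \<delta> + \<kappa> < length r" "i1 \<le> i" "i - i1 \<le> C" "i - C \<le> i1 - \<delta>"
        "(i1 - \<delta>) - (i - C) \<le> C"
        using i unfolding i1_def C_def by auto
      obtain c where c: "len c \<le> K0" "prod_list (take (i1 - \<delta>) p) * c = prod_list (take i1 r)"
        using early[OF i1(1)] by blast
      let ?x = "prod_list (take ((i1 - \<delta>) - (i - C)) (drop (i - C) p))"
      let ?y = "prod_list (take (i - i1) (drop i1 r))"
      have "prod_list (take (i - C) p) * (?x * c * ?y) = prod_list (take i r)"
        using c(2) prod_take_split[OF i1(2), of r] prod_take_split[OF i1(4), of p] by (metis mult.assoc)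
      moreover have "len (?x * c * ?y) \<le> K"
        using len_mult[of "?x * c" ?y] len_mult[of ?x c] c(1) i1 len_segment[OF p, of "i1 - \<delta>" "i - C"]
          len_segment[OF r, of i i1] unfolding K_def by linarith
      ultimately show ?thesis by blast
    qed
    ultimately show ?thesis by blast
  qed
  show ?thesis by (rule exI[of _ C], rule exI[of _ K]) (use main C_def in auto)
qed

section \<open>From fellow travelling to sweeps\<close>

definition shadows :: "'m set \<Rightarrow> 'm list \<Rightarrow> 'm list \<Rightarrow> bool" where
  "shadows S X Y \<longleftrightarrow> length X = length Y \<and> set X \<subseteq> S \<and> set Y \<subseteq> S \<and> prod_list X = prod_list Y \<and>
     (\<forall>i. \<exists>c\<in>S. prod_list (take i X) * c = prod_list (take i Y))"

text \<open>The carry at a boundary takes the prefix product of \<open>X\<close> to that of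
  \<open>Y\<close>. Cancelling the prefix of \<open>X\<close> turns two consecutive such equations
  into the local equation for one cell, and cancelling all of \<open>X\<close> makes the last carry
  \<open>1\<close>.\<close>

lemma shadows_sweep:
  assumes "shadows S X Y" shows "sweep S X Y"
proof -
  have s: "length X = length Y" "set X \<subseteq> S" "set Y \<subseteq> S" "prod_list X = prod_list Y"
    and "\<forall>i. \<exists>c. c \<in> S \<and> prod_list (take i X) * c = prod_list (take i Y)"
    using assms unfolding shadows_def by auto
  from choice[OF this(5)] obtain f
    where f: "\<And>i. f i \<in> S" "\<And>i. prod_list (take i X) * f i = prod_list (take i Y)"
    by blast
  have "X ! i * f (Suc i) = f i * Y ! i" if "i < length X" for i
  proof -
    have "prod_list (take i X) * (X ! i * f (Suc i)) = prod_list (take (Suc i) Y)"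
      using f(2)[of "Suc i"] that by (simp add: take_Suc_conv_app_nth mult.assoc)
    also have "\<dots> = prod_list (take i X) * (f i * Y ! i)"
      using f(2)[of i] that s(1) by (simp add: take_Suc_conv_app_nth flip: mult.assoc)
    finally show ?thesis by (rule lcancel)
  qed
  moreover have "f 0 = 1" using f(2)[of 0] by simp
  moreover have "f (length X) = 1"
    using f(2)[of "length X"] s lcancel[of "prod_list X" "f (length X)" 1] by simp
  ultimately show ?thesis using s f(1) unfolding sweep_def by blast
qed

lemma shadows_refl: "set X \<subseteq> S \<Longrightarrow> 1 \<in> S \<Longrightarrow> shadows S X X"
  unfolding shadows_def by (auto intro: bexI[of _ 1])

lemma shadows_append:
  assumes "shadows S X Y" "shadows S X' Y'"
  shows "shadows S (X @ X') (Y @ Y')"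
proof -
  have "\<exists>c\<in>S. prod_list (take i (X @ X')) * c = prod_list (take i (Y @ Y'))" for i
  proof (cases "i \<le> length X")
    case True
    then show ?thesis using assms(1) unfolding shadows_def by auto
  next
    case False
    from assms(2) obtain c where "c \<in> S"
      "prod_list (take (i - length X) X') * c = prod_list (take (i - length X) Y')"
      unfolding shadows_def by blast
    then show ?thesis using assms(1) False unfolding shadows_def
      by (intro bexI[of _ c]) (auto simp: mult.assoc)
  qed
  then show ?thesis using assms unfolding shadows_def by auto
qed

lemma prod_list_ones [simp]: "prod_list (replicate n 1) = (1::'m)"
  by (induction n) auto

text \<open>In the first pass \<open>C\<close> leading ones delay \<open>gword g\<close> by the
  \<open>C\<close> of \<open>fellow_travel\<close>, so the carries are short and the word of
  \<open>g * a\<close> is written at the left end of its block. The pass back shifts that word to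
  the right end, with segments of at most \<open>s\<close> letters as carries.\<close>

lemma round_multiply:
  "\<exists>K C. \<kappa> \<le> K \<and> (\<forall>g a e rest. len a \<le> \<kappa> \<and> C \<le> e \<and> set rest \<subseteq> gball K \<longrightarrow>
     sweep_round (gball K) (replicate e 1 @ gword g @ a # rest)
       (replicate (e + len g + 1 - len (g * a)) 1 @ gword (g * a) @ rest))"
proof -
  obtain C K0 where \<kappa>C: "\<kappa> \<le> C"
    and short: "\<And>p r a. geo p \<Longrightarrow> geo r \<Longrightarrow> len a \<le> \<kappa> \<Longrightarrow> prod_list p * a = prod_list r \<Longrightarrow>
      length p \<le> length r + K0"
    and ft: "\<And>p r a i. geo p \<Longrightarrow> geo r \<Longrightarrow> len a \<le> \<kappa> \<Longrightarrow> prod_list p * a = prod_list r \<Longrightarrow>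
      i \<le> length r \<Longrightarrow> \<exists>c. len c \<le> K0 \<and> prod_list (take (i - C) p) * c = prod_list (take i r)"
    using fellow_travel[of \<kappa>] by metis
  define K where "K = K0 + C + \<kappa> + 1"
  let ?S = "gball K"
  have "sweep_round ?S (replicate e 1 @ gword g @ a # rest)
       (replicate (e + len g + 1 - len (g * a)) 1 @ gword (g * a) @ rest)"
    if a: "len a \<le> \<kappa>" and e: "C \<le> e" and rest: "set rest \<subseteq> ?S" for g a e rest
  proof -
    let ?p = "gword g" and ?r = "gword (g * a)"
    have pr: "geo ?p" "geo ?r" "prod_list ?p * a = prod_list ?r" using gword by auto
    have lr: "len (g * a) \<le> len g + \<kappa>" using len_mult[of g a] a by simp
    have lp: "len g \<le> len (g * a) + K0" using short[OF pr(1,2) a pr(3)] by simp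
    have in_S: "set (gword h) \<subseteq> ?S" for h
      using set_gword[of h] len_gen unfolding K_def by fastforce
    have aS: "a \<in> ?S" using a unfolding K_def by simp
    \<comment> \<open>The number of ones left in the block of \<open>C + len g + 1\<close> cells;
      the subtraction is exact because \<open>\<kappa> \<le> C\<close>.\<close>
    define s where "s = C + len g + 1 - len (g * a)"
    have s: "len (g * a) + s = C + len g + 1" "s \<le> K" using lr lp \<kappa>C unfolding s_def K_def by auto
    have core: "shadows ?S (replicate C 1 @ ?p @ [a]) (?r @ replicate s 1)"
    proof -
      have "\<exists>c\<in>?S. prod_list (take i (replicate C 1 @ ?p @ [a])) * c = prod_list (take i (?r @ replicate s 1))"
        for i
      proof -
        \<comment> \<open>In \<open>out\<close> both words are complete; in \<open>left\<close>
          fellow travelling applies; in \<open>mid\<close> the word \<open>?r\<close> has ended, and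
          the carry is the rest of \<open>?p\<close> followed by \<open>a\<close>.\<close>
        consider (out) "C + len g < i" | (left) "i \<le> C + len g" "i \<le> len (g * a)"
          | (mid) "i \<le> C + len g" "len (g * a) < i" by linarith
        then show ?thesis
        proof cases
          case out
          then show ?thesis using gword(2) s by (intro bexI[of _ 1]) auto
        next
          case left
          obtain c where "len c \<le> K0" "prod_list (take (i - C) ?p) * c = prod_list (take i ?r)"
            using ft[OF pr(1,2) a pr(3), of i] left by auto
          then show ?thesis using left by (intro bexI[of _ c]) (auto simp: K_def)
        next
          case mid
          let ?c = "prod_list (drop (i - C) ?p) * a"
          have "len ?c \<le> K"
            using len_mult[of "prod_list (drop (i - C) ?p)" a] a geo_drop[OF pr(1), of "i - C"] lp mid
            unfolding K_def geo_def by auto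
          moreover have "prod_list (take (i - C) ?p) * ?c = g * a"
            using prod_take_drop[of "i - C" ?p] gword(2)[of g] by (simp flip: mult.assoc)
          ultimately show ?thesis using mid gword(2) by (intro bexI[of _ ?c]) auto
        qed
      qed
      then show ?thesis unfolding shadows_def using in_S aS s gword(2)
        by (auto simp: set_replicate_conv_if)
    qed
    have shift: "shadows ?S (replicate s 1 @ ?r) (?r @ replicate s 1)"
    proof -
      have "\<exists>c\<in>?S. prod_list (take i (replicate s 1 @ ?r)) * c = prod_list (take i (?r @ replicate s 1))"
        for i
      proof -
        let ?c = "prod_list (take (i - (i - s)) (drop (i - s) ?r))"
        have "len ?c \<le> K" using len_segment[OF pr(2), of i "i - s"] s(2) by simp
        moreover have "prod_list (take (i - s) ?r) * ?c = prod_list (take i ?r)"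
          by (rule prod_take_split[symmetric]) simp
        ultimately show ?thesis by (intro bexI[of _ ?c]) auto
      qed
      then show ?thesis unfolding shadows_def using in_S s
        by (auto simp: set_replicate_conv_if)
    qed
    let ?pad = "replicate (e - C) (1::'m)"
    have pad: "shadows ?S ?pad ?pad" and tail: "shadows ?S rest rest"
      using rest by (auto intro!: shadows_refl simp: set_replicate_conv_if split: if_splits)
    have e1: "replicate e 1 @ ?p @ a # rest = ?pad @ (replicate C 1 @ ?p @ [a]) @ rest"
      using e by (simp flip: replicate_add append_assoc)
    have "e + len g + 1 - len (g * a) = (e - C) + s" using e s by linarith
    then have e2: "replicate (e + len g + 1 - len (g * a)) 1 @ ?r @ rest = ?pad @ (replicate s 1 @ ?r) @ rest"
      by (simp add: replicate_add)
    show ?thesis unfolding sweep_round_def e1 e2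
      using shadows_append[OF pad shadows_append[OF core tail]]
        shadows_append[OF pad shadows_append[OF shift tail]] shadows_sweep by blast
  qed
  then show ?thesis by (rule_tac exI[of _ K], rule_tac exI[of _ C]) (auto simp: K_def)
qed

text \<open>Each round absorbs one more letter into the geodesic word of the prefix read so far.
  That word has at most \<open>\<kappa>\<close> times as many letters as were absorbed, so with
  \<open>E\<close> ones at the start at least \<open>C\<close> of them remain for the next
  round.\<close>

lemma rounds_normalise:
  "\<exists>K C. \<kappa> \<le> K \<and> (\<forall>zs E. (\<forall>a\<in>set zs. len a \<le> \<kappa>) \<and> C + \<kappa> * length zs \<le> E \<longrightarrow>
     (sweep_round (gball K) ^^ length zs) (replicate E 1 @ zs)
       (replicate (E + length zs - len (prod_list zs)) 1 @ gword (prod_list zs)))"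
proof -
  obtain K C where K: "\<kappa> \<le> K" and step: "\<And>g a e rest. len a \<le> \<kappa> \<Longrightarrow> C \<le> e \<Longrightarrow> set rest \<subseteq> gball K \<Longrightarrow>
     sweep_round (gball K) (replicate e 1 @ gword g @ a # rest)
       (replicate (e + len g + 1 - len (g * a)) 1 @ gword (g * a) @ rest)"
    using round_multiply[of \<kappa>] by meson
  have "(sweep_round (gball K) ^^ n) (replicate E 1 @ zs)
       (replicate (E + n - len (prod_list (take n zs))) 1 @ gword (prod_list (take n zs)) @ drop n zs)"
    if zs: "\<forall>a\<in>set zs. len a \<le> \<kappa>" and E: "C + \<kappa> * length zs \<le> E" and n: "n \<le> length zs" for zs E n
    using n
  proof (induction n)
    case 0
    have "gword 1 = []" by (metis length_gword len_1 length_0_conv)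
    then show ?case by simp
  next
    case (Suc n)
    let ?g = "prod_list (take n zs)" and ?a = "zs ! n"
    have n: "n < length zs" using Suc.prems by simp
    have lg: "len ?g \<le> \<kappa> * n"
      using len_prod_list[of "take n zs" \<kappa>] zs n by (auto dest: in_set_takeD)
    also have "\<kappa> * n \<le> \<kappa> * length zs" using n by simp
    finally have e: "C \<le> E + n - len ?g" "len ?g \<le> E" using E by auto
    have rest: "set (drop (Suc n) zs) \<subseteq> gball K"
      using zs K by (force dest: in_set_dropD)
    have ga: "prod_list (take (Suc n) zs) = ?g * ?a" using n by (simp add: take_Suc_conv_app_nth)
    have ex: "E + n - len ?g + len ?g + 1 - len (?g * ?a) = E + Suc n - len (?g * ?a)" using e by simp
    have "sweep_round (gball K) (replicate (E + n - len ?g) 1 @ gword ?g @ drop n zs)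
       (replicate (E + Suc n - len (?g * ?a)) 1 @ gword (?g * ?a) @ drop (Suc n) zs)"
      using step[OF _ e(1) rest, of ?a ?g] zs n unfolding ex by (simp add: Cons_nth_drop_Suc)
    then show ?case using Suc.IH n unfolding ga by (auto intro: relcomppI)
  qed
  then have "(sweep_round (gball K) ^^ length zs) (replicate E 1 @ zs)
       (replicate (E + length zs - len (prod_list zs)) 1 @ gword (prod_list zs))"
    if "\<forall>a\<in>set zs. len a \<le> \<kappa>" "C + \<kappa> * length zs \<le> E" for zs E
    using that order_refl[of "length zs"] by fastforce
  then show ?thesis using K by blast
qed

section \<open>Linear bounds on the length of factors\<close>

lemma near_card_bounded:
  "\<exists>k. \<forall>V f g a b. V \<subseteq> {v. \<exists>i\<le>a. \<exists>s. len s \<le> \<delta> \<and> f i * s = v} \<union>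
      {v. \<exists>i\<le>b. \<exists>s. len s \<le> \<delta> \<and> v * s = g i} \<longrightarrow> card V \<le> k * (a + b + 1)"
proof -
  obtain D where D: "\<And>y. finite {x. \<exists>s. len s \<le> \<delta> \<and> x * s = y}"
      "\<And>y. card {x. \<exists>s. len s \<le> \<delta> \<and> x * s = y} \<le> D"
    using in_ball_bounded by blast
  \<comment> \<open>\<open>N\<close> bounds the out-balls, which are left translates of
    \<open>gball \<delta>\<close>, and \<open>D\<close> bounds the in-balls.\<close>
  define N where "N = card (gball \<delta>)"
  have "card V \<le> (2 * (N + D)) * (a + b + 1)"
    if V: "V \<subseteq> {v. \<exists>i\<le>a. \<exists>s. len s \<le> \<delta> \<and> f i * s = v} \<union>
      {v. \<exists>i\<le>b. \<exists>s. len s \<le> \<delta> \<and> v * s = g i}" for V :: "'m set" and f g a b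
  proof -
    let ?P = "\<Union>i\<in>{..a}. (*) (f i) ` gball \<delta>" and ?Q = "\<Union>i\<in>{..b}. {x. \<exists>s. len s \<le> \<delta> \<and> x * s = g i}"
    have "card ?P \<le> (\<Sum>i\<in>{..a}. card ((*) (f i) ` gball \<delta>))" by (rule card_UN_le) simp
    also have "\<dots> \<le> (\<Sum>i\<in>{..a}. N)" unfolding N_def by (intro sum_mono card_image_le finite_gball)
    finally have P: "card ?P \<le> (a + 1) * N" by simp
    have "card ?Q \<le> (\<Sum>i\<in>{..b}. card {x. \<exists>s. len s \<le> \<delta> \<and> x * s = g i})" by (rule card_UN_le) simp
    also have "\<dots> \<le> (\<Sum>i\<in>{..b}. D)" by (intro sum_mono D)
    finally have Q: "card ?Q \<le> (b + 1) * D" by simp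
    have "V \<subseteq> ?P \<union> ?Q" 
    proof
      fix v assume "v \<in> V"
      with V consider i s where "i \<le> a" "len s \<le> \<delta>" "f i * s = v"
        | i s where "i \<le> b" "len s \<le> \<delta>" "v * s = g i" by blast
      then show "v \<in> ?P \<union> ?Q"
      proof cases
        case (1 i s)
        then show ?thesis by (intro UnI1 UN_I[of i] image_eqI[of _ _ s]) auto
      qed auto
    qed
    then have "card V \<le> card (?P \<union> ?Q)" using D(1) finite_gball by (intro card_mono) auto
    also have "\<dots> \<le> card ?P + card ?Q" by (rule card_Un_le)
    also have "\<dots> \<le> (a + 1) * N + (b + 1) * D" using P Q by (rule add_mono)
    also have "\<dots> \<le> (2 * (N + D)) * (a + b + 1)" by (simp add: algebra_simps)
    finally show ?thesis .
  qed
  then show ?thesis by blast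
qed

text \<open>The word of \<open>m\<close> is the first side of the triangle for \<open>m * y\<close>
  and the second side of that for \<open>y * m\<close>. Its \<open>len m + 1\<close> distinct
  vertices lie in balls around the other two sides.\<close>

lemma factor_len_bounded:
  "\<exists>k. (\<forall>m y. len m \<le> k * (len (m * y) + len y + 1)) \<and> (\<forall>m y. len m \<le> k * (len y + len (y * m) + 1))"
proof -
  obtain k where k: "\<And>V f g a b. V \<subseteq> {v. \<exists>i\<le>a. \<exists>s. len s \<le> \<delta> \<and> f i * s = v} \<union>
      {v. \<exists>i\<le>b. \<exists>s. len s \<le> \<delta> \<and> v * s = g i} \<Longrightarrow> card V \<le> k * (a + b + 1)"
    using near_card_bounded by meson
  have "len m \<le> k * (len (m * y) + len y + 1)" for m y
  proof -
    let ?V = "(\<lambda>j. prod_list (take j (gword m))) ` {..len m}"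
    have "?V \<subseteq> {v. \<exists>i\<le>len (m * y). \<exists>s. len s \<le> \<delta> \<and> prod_list (take i (gword (m * y))) * s = v} \<union>
      {v. \<exists>i\<le>len y. \<exists>s. len s \<le> \<delta> \<and> v * s = m * prod_list (take i (gword y))}"
      using thin_first[of "gword m" "gword y" "gword (m * y)"] gword by auto
    then have "card ?V \<le> k * (len (m * y) + len y + 1)" by (rule k)
    moreover have "card ?V = len m + 1"
      using card_image[OF inj_on_prefixes[OF gword(1)[of m]]] by simp
    ultimately show ?thesis by linarith
  qed
  moreover have "len m \<le> k * (len y + len (y * m) + 1)" for m y
  proof -
    let ?V = "(\<lambda>j. y * prod_list (take j (gword m))) ` {..len m}"
    have "?V \<subseteq> {v. \<exists>i\<le>len y. \<exists>s. len s \<le> \<delta> \<and> prod_list (take i (gword y)) * s = v} \<union>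
      {v. \<exists>i\<le>len (y * m). \<exists>s. len s \<le> \<delta> \<and> v * s = prod_list (take i (gword (y * m)))}"
      using thin_second[of "gword y" "gword m" "gword (y * m)"] gword by auto
    then have "card ?V \<le> k * (len y + len (y * m) + 1)" by (rule k)
    \<comment> \<open>Translating the prefixes by \<open>y\<close> keeps them distinct by left
      cancellativity.\<close>
    moreover have "inj_on (\<lambda>j. y * prod_list (take j (gword m))) {..len m}"
      using inj_on_prefixes[OF gword(1)[of m]] by (auto simp: inj_on_def)
    then have "card ?V = len m + 1" using card_image by fastforce
    ultimately show ?thesis by linarith
  qed
  ultimately show ?thesis by blast
qed

section \<open>Assembling the machine for the two orders\<close>

lemma sy_exists:
  "\<exists>sy :: nat \<Rightarrow> 'm \<Rightarrow> 'm \<Rightarrow> nat.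
     (\<forall>k x y k' x' y'. sy k x y = sy k' x' y' \<longleftrightarrow> k = k' \<and> x = x' \<and> y = y') \<and> (\<forall>k x y. sy k x y \<noteq> 0)"
proof -
  obtain e :: "'m \<Rightarrow> nat" where e: "inj_on e B"
    using finite_imp_inj_to_nat_seg[OF finite_B] by blast
  \<comment> \<open>The chosen geodesic word, a list over the finite set \<open>B\<close>, serves as
    a name for its product.\<close>
  define f where "f m = list_encode (map e (gword m))" for m
  have f: "f x = f y \<longleftrightarrow> x = y" for x y
  proof
    assume "f x = f y"
    then have "map e (gword x) = map e (gword y)" unfolding f_def by (simp add: list_encode_eq)
    then have "gword x = gword y"
      using inj_on_map_eq_map[of e "gword x" "gword y"] inj_on_subset[OF e] set_gword by (metis Un_least)
    then show "x = y" using gword(2) by metis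
  qed simp
  \<comment> \<open>The outer \<open>Suc\<close> reserves 0 for the blank.\<close>
  show ?thesis
    by (rule exI[of _ "\<lambda>k x y. Suc (prod_encode (k, prod_encode (f x, f y)))"]) (simp add: f)
qed

text \<open>For correct guesses the two tracks have the same length and the same product, so the
  same number of rounds brings them to the same word, a geodesic with ones in front.\<close>

lemma rel_in_NP_if_factors:
  assumes "finite A" and G: "1 \<in> GL" "1 \<in> GR" "GL \<subseteq> insert 1 B" "GR \<subseteq> insert 1 B"
    and Rel: "\<And>x y. Rel x y \<longleftrightarrow> (\<exists>l r. set l \<subseteq> GL \<and> set r \<subseteq> GR \<and> x = prod_list l * y * prod_list r)"
    and short: "\<And>x y. Rel x y \<Longrightarrow> \<exists>l r. set l \<subseteq> GL \<and> set r \<subseteq> GR \<and> x = prod_list l * y * prod_list r \<and>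
      length l + length r \<le> k * (len x + len y + 1)"
  shows "rel_in_NP A Rel"
proof -
  define \<kappa> where "\<kappa> = Max (insert 1 (len ` A))"
  have \<kappa>: "1 \<le> \<kappa>" "\<And>a. a \<in> A \<Longrightarrow> len a \<le> \<kappa>" unfolding \<kappa>_def using assms(1) by auto
  obtain K C where K: "\<kappa> \<le> K" and norm: "\<And>zs E. (\<forall>a\<in>set zs. len a \<le> \<kappa>) \<Longrightarrow> C + \<kappa> * length zs \<le> E \<Longrightarrow>
     (sweep_round (gball K) ^^ length zs) (replicate E 1 @ zs)
       (replicate (E + length zs - len (prod_list zs)) 1 @ gword (prod_list zs))"
    using rounds_normalise[of \<kappa>] by blast
  have G\<kappa>: "len g \<le> \<kappa>" if "g \<in> insert 1 B" for g using that len_gen[of g] \<kappa> by auto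
  obtain sy :: "nat \<Rightarrow> 'm \<Rightarrow> 'm \<Rightarrow> nat"
    where sy: "\<And>k x y k' x' y'. sy k x y = sy k' x' y' \<longleftrightarrow> k = k' \<and> x = x' \<and> y = y'" "\<And>k x y. sy k x y \<noteq> 0"
    using sy_exists by blast
  interpret sweep_machine sy "gball K" A GL GR
  proof unfold_locales
    show "A \<subseteq> gball K" using \<kappa>(2) K by force
    show "GL \<subseteq> gball K" "GR \<subseteq> gball K" using G G\<kappa> K by force+
  qed (use sy finite_gball G in auto)
  show ?thesis
  \<comment> \<open>The tape has \<open>E + n = C + (\<kappa> + 1) * n\<close> cells, and
    \<open>n\<close> is at most \<open>k * \<kappa> + 1\<close> times
    \<open>length u + length v + 1\<close>.\<close>
  proof (rule rel_in_NP_if_rounds[where k = "C + (\<kappa> + 1) * (k * \<kappa> + 1)"])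
    show "Rel x y \<longleftrightarrow> x \<in> products y" for x y unfolding Rel products_def by auto
    fix u v assume uv: "set u \<subseteq> A" "set v \<subseteq> A" and rel: "Rel (prod_list u) (prod_list v)"
    let ?n = "length u + length v"
    obtain l r where lr: "set l \<subseteq> GL" "set r \<subseteq> GR" "prod_list u = prod_list l * prod_list v * prod_list r"
      and llr: "length l + length r \<le> k * (len (prod_list u) + len (prod_list v) + 1)"
      using short[OF rel] by blast
    define n where "n = length l + length u + 1 + length v + length r"
    \<comment> \<open>The ones needed by \<open>norm\<close> are guessed too:
      \<open>1 \<in> GL\<close> allows \<open>E\<close> extra letters in front of
      \<open>l\<close>.\<close>
    define E where "E = C + \<kappa> * n"
    let ?l = "replicate E 1 @ l"
    let ?X1 = "replicate (length l) 1 @ u @ 1 # replicate (length v + length r) 1"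
    let ?X2 = "l @ replicate (length u) 1 @ 1 # v @ r"
    let ?X = "replicate (E + n - len (prod_list u)) 1 @ gword (prod_list u)"
    have t1: "map fst (tracks ?l u v r) = replicate E 1 @ ?X1" and t2: "map snd (tracks ?l u v r) = replicate E 1 @ ?X2"
      unfolding tracks_def by (simp_all add: comp_def map_replicate_const replicate_add)
    have "(sweep_round (gball K) ^^ length ?X1) (replicate E 1 @ ?X1)
        (replicate (E + length ?X1 - len (prod_list ?X1)) 1 @ gword (prod_list ?X1))"
      using uv \<kappa> by (intro norm) (auto simp: E_def n_def set_replicate_conv_if)
    then have r1: "(sweep_round (gball K) ^^ n) (map fst (tracks ?l u v r)) ?X"
      unfolding t1 by (simp add: n_def ac_simps)
    have "(sweep_round (gball K) ^^ length ?X2) (replicate E 1 @ ?X2)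
        (replicate (E + length ?X2 - len (prod_list ?X2)) 1 @ gword (prod_list ?X2))"
      using uv \<kappa> lr G G\<kappa> by (intro norm) (auto simp: E_def n_def set_replicate_conv_if)
    moreover have "prod_list ?X2 = prod_list u" using lr(3) by (simp add: mult.assoc)
    moreover have "length ?X2 = n" by (simp add: n_def)
    ultimately have r2: "(sweep_round (gball K) ^^ n) (map snd (tracks ?l u v r)) ?X"
      unfolding t2 by metis
    have N: "length (tracks ?l u v r) = E + n" unfolding tracks_def n_def by simp
    have "len (prod_list u) \<le> \<kappa> * length u" "len (prod_list v) \<le> \<kappa> * length v"
      using uv \<kappa>(2) by (auto intro!: len_prod_list)
    then have "len (prod_list u) + len (prod_list v) + 1 \<le> \<kappa> * (?n + 1)"
      using \<kappa>(1) by (simp add: algebra_simps)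
    then have "length l + length r \<le> k * (\<kappa> * (?n + 1))" using llr order_trans mult_le_mono2 by blast
    then have "n \<le> (k * \<kappa> + 1) * (?n + 1)" unfolding n_def by (simp add: algebra_simps)
    then have "(\<kappa> + 1) * n \<le> (\<kappa> + 1) * ((k * \<kappa> + 1) * (?n + 1))" by (rule mult_le_mono2)
    moreover have "E + n = C + (\<kappa> + 1) * n" unfolding E_def by simp
    moreover have "C \<le> C * (?n + 1)" by simp
    ultimately have "E + n \<le> C * (?n + 1) + (\<kappa> + 1) * ((k * \<kappa> + 1) * (?n + 1))" by linarith
    also have "\<dots> = (C + (\<kappa> + 1) * (k * \<kappa> + 1)) * (?n + 1)" by (simp add: algebra_simps)
    finally have bound: "E + n \<le> (C + (\<kappa> + 1) * (k * \<kappa> + 1)) * (?n + 1)" .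
    have "insert 1 B \<subseteq> gball K" using G\<kappa> K by force
    moreover have "set ?X \<subseteq> insert 1 B"
      using set_gword[of "prod_list u"] by (auto simp: set_replicate_conv_if)
    ultimately have "set ?X \<subseteq> gball K" by blast
    moreover have "set ?l \<subseteq> GL" using lr G by auto
    ultimately show "\<exists>l r X n. set l \<subseteq> GL \<and> set r \<subseteq> GR \<and> set X \<subseteq> gball K \<and>
        (sweep_round (gball K) ^^ n) (map fst (tracks l u v r)) X \<and>
        (sweep_round (gball K) ^^ n) (map snd (tracks l u v r)) X \<and>
        n \<le> length (tracks l u v r) \<and>
        length (tracks l u v r) \<le> (C + (\<kappa> + 1) * (k * \<kappa> + 1)) * (length u + length v + 1)"
      using lr(2) r1 r2 N bound
      by (intro exI[of _ ?l] exI[of _ r] exI[of _ ?X] exI[of _ n]) (simp only: le_add2)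
  qed
qed

text \<open>The unknown factor is guessed on the left for one order and on the right for the other;
  the opposite side admits only \<open>1\<close>, which leaves the product unchanged and still
  provides the initial ones.\<close>

lemma orders_in_NP:
  assumes "finite A"
  shows "rel_in_NP A (L_le :: 'm \<Rightarrow> 'm \<Rightarrow> bool)" "rel_in_NP A (R_le :: 'm \<Rightarrow> 'm \<Rightarrow> bool)"
proof -
  obtain k where k1: "\<And>m y. len m \<le> k * (len (m * y) + len y + 1)"
    and k2: "\<And>m y. len m \<le> k * (len y + len (y * m) + 1)"
    using factor_len_bounded by blast
  have gB: "set (gword m) \<subseteq> insert 1 B" for m using set_gword by blast
  show "rel_in_NP A (L_le :: 'm \<Rightarrow> 'm \<Rightarrow> bool)"
  proof (rule rel_in_NP_if_factors[where GL = "insert 1 B" and GR = "{1}" and k = k, OF assms])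
    fix x y :: 'm
    show "L_le x y \<longleftrightarrow> (\<exists>l r. set l \<subseteq> insert 1 B \<and> set r \<subseteq> {1} \<and> x = prod_list l * y * prod_list r)"
      unfolding L_le_iff
    proof
      assume "\<exists>m. x = m * y"
      then obtain m where "x = m * y" by blast
      then show "\<exists>l r. set l \<subseteq> insert 1 B \<and> set r \<subseteq> {1} \<and> x = prod_list l * y * prod_list r"
        using gB[of m] gword(2)[of m] by (intro exI[of _ "gword m"] exI[of _ "[]"]) simp
    qed (use prod_list_eq_1 in fastforce)
    assume "L_le x y"
    then obtain m where "x = m * y" unfolding L_le_iff by blast
    then show "\<exists>l r. set l \<subseteq> insert 1 B \<and> set r \<subseteq> {1} \<and> x = prod_list l * y * prod_list r \<and>
        length l + length r \<le> k * (len x + len y + 1)"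
      using gB[of m] gword(2)[of m] k1[of m y] by (intro exI[of _ "gword m"] exI[of _ "[]"]) simp
  qed auto
  show "rel_in_NP A (R_le :: 'm \<Rightarrow> 'm \<Rightarrow> bool)"
  proof (rule rel_in_NP_if_factors[where GL = "{1}" and GR = "insert 1 B" and k = k, OF assms])
    fix x y :: 'm
    show "R_le x y \<longleftrightarrow> (\<exists>l r. set l \<subseteq> {1} \<and> set r \<subseteq> insert 1 B \<and> x = prod_list l * y * prod_list r)"
      unfolding R_le_iff
    proof
      assume "\<exists>m. x = y * m"
      then obtain m where "x = y * m" by blast
      then show "\<exists>l r. set l \<subseteq> {1} \<and> set r \<subseteq> insert 1 B \<and> x = prod_list l * y * prod_list r"
        using gB[of m] gword(2)[of m] by (intro exI[of _ "[]"] exI[of _ "gword m"]) simp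
    qed (use prod_list_eq_1 in fastforce)
    assume "R_le x y"
    then obtain m where "x = y * m" unfolding R_le_iff by blast
    then show "\<exists>l r. set l \<subseteq> {1} \<and> set r \<subseteq> insert 1 B \<and> x = prod_list l * y * prod_list r \<and>
        length l + length r \<le> k * (len x + len y + 1)"
      using gB[of m] gword(2)[of m] k2[of m y]
      by (intro exI[of _ "[]"] exI[of _ "gword m"]) (simp add: add.commute)
  qed auto
qed

end

theorem theorem6p2:
  fixes A :: "'m::monoid_mult set"
  assumes "finite A" and "generates A"
    and "left_cancellative TYPE('m)"
    and "bounded_indegree A"
    and "strongly_hyperbolic_monoid TYPE('m)"
  shows "rel_in_NP A (L_le :: 'm \<Rightarrow> 'm \<Rightarrow> bool) \<and> rel_in_NP A (R_le :: 'm \<Rightarrow> 'm \<Rightarrow> bool)"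
proof -
  obtain B :: "'m set" and \<delta> where B: "finite B" "generates B" "strongly_hyperbolic_cayley B \<delta>"
    using assms(5) unfolding strongly_hyperbolic_monoid_def by blast
  \<comment> \<open>Lengths and geodesics refer to the hyperbolic generating set \<open>B\<close>,
    while the input words remain over \<open>A\<close>.\<close>
  interpret hyperbolic_cayley B \<delta>
    using B assms(3) bounded_indegree_all[OF assms(4,2)]
    by unfold_locales (auto simp: left_cancellative_def)
  show ?thesis using orders_in_NP[OF assms(1)] by blast
qed

end
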